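(* Let $\varphi=\frac{1+\sqrt5}{2}$ and $\varphi_0=\sqrt{2\varphi^2+1}$. Then the following hold. (1) For every nontrivial $w\in F(a,b)$, with $n$ the cyclically reduced length of $w$, we have \[ \|f_w\|_\infty\le 2\varphi_0^n, \qquad \|f_w\|_1\le 2\binom{n+3}{3}\varphi_0^n. \] (2) There exists $c>0$ such that for all $n\ge 1$ we have \[ \|f_{a^n}\|_1\ge c\,\varphi^n \qquad\text{and}\qquad \|f_{a^n}\|_\infty\ge c\,\varphi^n/\sqrt n. \]
   Context: $F(a,b)$ is the free group on $a,b$. For $w\in F(a,b)$ and $A,B\in \mathrm{SL}(2,\mathbb C)$, $w(A,B)$ denotes the image of $w$ under $a\mapsto A$, $b\mapsto B$. The trace polynomial $f_w(x,y,z)\in\mathbb Z[x,y,z]$ is the unique polynomial such that $\mathrm{Tr}(w(A,B))=f_w(\mathrm{Tr}A,\mathrm{Tr}B,\mathrm{Tr}(AB))$ for all $A,B\in \mathrm{SL}(2,\mathbb C)$ (its existence and uniqueness are classical). The cyclically reduced length of $w$ is the length of any cyclically reduced word conjugate to $w$ in $F(a,b)$. For $f\in\mathbb Z[x,y,z]$, $[x^iy^jz^k]f$ is the coefficient of $x^iy^jz^k$ in $f$, $\|f\|_\infty=\max_{i,j,k}|[x^iy^jz^k]f|$ and $\|f\|_1=\sum_{i,j,k}|[x^iy^jz^k]f|$. *)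

theory Defs
  imports
    "HOL-Analysis.Determinants"
    "HOL-Library.Poly_Mapping"
    "HOL-Library.Product_Plus"
    "HOL-Algebra.Group"
begin

section \<open>The free group on two generators\<close>

datatype gen = Gen_a | Gen_b

text \<open>A letter is a generator with an exponent: \<open>(g, True)\<close> stands for \<open>g\<close> and
  \<open>(g, False)\<close> for its inverse.\<close>

type_synonym letter = "gen \<times> bool"

definition inv_letter :: "letter \<Rightarrow> letter" where
  "inv_letter x = (fst x, \<not> snd x)"

fun reduced :: "letter list \<Rightarrow> bool" where
  "reduced (x # y # w) \<longleftrightarrow> y \<noteq> inv_letter x \<and> reduced (y # w)"
| "reduced w \<longleftrightarrow> True"

fun cons_reduce :: "letter \<Rightarrow> letter list \<Rightarrow> letter list" where
  "cons_reduce x [] = [x]"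
| "cons_reduce x (y # w) = (if y = inv_letter x then w else x # y # w)"

text \<open>Elements are represented by their unique reduced words; the product is the free reduction
  of the concatenation.\<close>

definition F2 :: "letter list monoid" where
  "F2 = \<lparr>carrier = {w. reduced w}, monoid.mult = (\<lambda>u v. foldr cons_reduce u v), one = []\<rparr>"

definition gen_a :: "letter list" where
  "gen_a = [(Gen_a, True)]"

lemma inv_letter_inv_letter [simp]: "inv_letter (inv_letter x) = x"
  by (simp add: inv_letter_def)

lemma inv_letter_neq [simp]: "inv_letter x \<noteq> x" "x \<noteq> inv_letter x"
  by (auto simp: inv_letter_def prod_eq_iff)

lemma reduced_ConsD: "reduced (x # w) \<Longrightarrow> reduced w"
  by (cases w) auto

lemma reduced_cons_reduce: "reduced w \<Longrightarrow> reduced (cons_reduce x w)"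
  by (cases w) (auto dest: reduced_ConsD)

lemma reduced_foldr: "reduced v \<Longrightarrow> reduced (foldr cons_reduce u v)"
  by (induction u) (auto intro: reduced_cons_reduce)

lemma cons_reduce_cancel:
  assumes "reduced w"
  shows "cons_reduce (inv_letter x) (cons_reduce x w) = w"
proof (cases w)
  case (Cons y v)
  with assms show ?thesis by (cases v) auto
qed auto

lemma foldr_cons_reduce:
  assumes "reduced v"
  shows "foldr cons_reduce (cons_reduce x w) v = cons_reduce x (foldr cons_reduce w v)"
proof (cases w)
  case (Cons y u)
  show ?thesis
    using cons_reduce_cancel[OF reduced_foldr[OF assms], of "inv_letter x" u] Cons by auto
qed auto

lemma foldr_assoc:
  "reduced z \<Longrightarrow>
    foldr cons_reduce (foldr cons_reduce u v) z = foldr cons_reduce u (foldr cons_reduce v z)"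
  by (induction u) (auto simp: foldr_cons_reduce)

lemma foldr_cons_reduce_Nil: "reduced w \<Longrightarrow> foldr cons_reduce w [] = w"
proof (induction w)
  case (Cons x w)
  then show ?case by (cases w) auto
qed auto

lemma foldr_inverse:
  "reduced v \<Longrightarrow> foldr cons_reduce (rev (map inv_letter w)) (foldr cons_reduce w v) = v"
  by (induction w) (auto simp: cons_reduce_cancel reduced_foldr)

lemma group_F2: "group F2"
proof (rule groupI)
  fix w assume "w \<in> carrier F2"
  then have w: "reduced w" by (simp add: F2_def)
  define u where "u = foldr cons_reduce (rev (map inv_letter w)) []"
  have "reduced u" by (simp add: u_def reduced_foldr)
  moreover have "foldr cons_reduce u w = []"
    using foldr_inverse[of "[]" w] w by (simp add: u_def foldr_assoc foldr_cons_reduce_Nil)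
  ultimately show "\<exists>u\<in>carrier F2. u \<otimes>\<^bsub>F2\<^esub> w = \<one>\<^bsub>F2\<^esub>" by (auto simp: F2_def)
qed (auto simp: F2_def reduced_foldr foldr_assoc)

definition cyclically_reduced :: "letter list \<Rightarrow> bool" where
  "cyclically_reduced w \<longleftrightarrow> reduced w \<and> (w \<noteq> [] \<longrightarrow> last w \<noteq> inv_letter (hd w))"

definition conjugate_F2 :: "letter list \<Rightarrow> letter list \<Rightarrow> bool" where
  "conjugate_F2 u w \<longleftrightarrow> (\<exists>g\<in>carrier F2. u = g \<otimes>\<^bsub>F2\<^esub> w \<otimes>\<^bsub>F2\<^esub> inv\<^bsub>F2\<^esub> g)"

definition cyclically_reduced_length :: "letter list \<Rightarrow> nat" where
  "cyclically_reduced_length w =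
    (THE n. \<exists>u. cyclically_reduced u \<and> conjugate_F2 u w \<and> length u = n)"


section \<open>Evaluation of words at pairs of matrices\<close>

definition SL2 :: "(complex^2^2) set" where
  "SL2 = {A. det A = 1}"

definition letter_eval :: "complex^2^2 \<Rightarrow> complex^2^2 \<Rightarrow> letter \<Rightarrow> complex^2^2" where
  "letter_eval A B x =
    (let M = (case fst x of Gen_a \<Rightarrow> A | Gen_b \<Rightarrow> B) in if snd x then M else matrix_inv M)"

definition word_eval :: "complex^2^2 \<Rightarrow> complex^2^2 \<Rightarrow> letter list \<Rightarrow> complex^2^2" where
  "word_eval A B w = foldr (\<lambda>x M. letter_eval A B x ** M) w (mat 1)"

lemma letter_eval_inv_letter:
  assumes "A \<in> SL2" "B \<in> SL2"
  shows "letter_eval A B x ** letter_eval A B (inv_letter x) = mat 1"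
proof -
  have "invertible A" "invertible B"
    using assms by (auto simp: SL2_def invertible_det_nz)
  then have "A ** matrix_inv A = mat 1 \<and> matrix_inv A ** A = mat 1"
    "B ** matrix_inv B = mat 1 \<and> matrix_inv B ** B = mat 1"
    unfolding invertible_def matrix_inv_def by - (erule someI_ex)+
  then show ?thesis
    by (auto simp: letter_eval_def inv_letter_def Let_def split: gen.splits)
qed

lemma word_eval_mult:
  assumes "A \<in> SL2" "B \<in> SL2"
  shows "word_eval A B (u \<otimes>\<^bsub>F2\<^esub> v) = word_eval A B u ** word_eval A B v"
proof -
  have *: "word_eval A B (cons_reduce x w) = letter_eval A B x ** word_eval A B w" for x w
    using letter_eval_inv_letter[OF assms, of x]
    by (cases w) (auto simp: word_eval_def matrix_mul_assoc)
  have "word_eval A B (foldr cons_reduce u v) = word_eval A B u ** word_eval A B v"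
  proof (induction u)
    case Nil
    then show ?case by (simp add: word_eval_def)
  next
    case (Cons x u)
    then show ?case by (simp add: *) (simp add: word_eval_def matrix_mul_assoc)
  qed
  then show ?thesis by (simp add: F2_def)
qed


section \<open>Integer polynomials in three variables\<close>

text \<open>\<open>\<int>[x,y,z]\<close> as the monoid ring of the additive monoid of exponent triples:
  \<open>lookup f (i, j, k)\<close> is the coefficient of \<open>x^i y^j z^k\<close>.\<close>

type_synonym poly3 = "(nat \<times> nat \<times> nat) \<Rightarrow>\<^sub>0 int"

definition eval3 :: "poly3 \<Rightarrow> complex \<Rightarrow> complex \<Rightarrow> complex \<Rightarrow> complex" where
  "eval3 f x y z =
    (\<Sum>(i, j, k)\<in>Poly_Mapping.keys f.
      of_int (Poly_Mapping.lookup f (i, j, k)) * x ^ i * y ^ j * z ^ k)"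

text \<open>The maximum is taken over all monomials; only finitely many coefficients are nonzero, so the
  set of values is finite.\<close>

definition norm_inf :: "poly3 \<Rightarrow> int" where
  "norm_inf f = Max (range (\<lambda>m. \<bar>Poly_Mapping.lookup f m\<bar>))"

definition norm_one :: "poly3 \<Rightarrow> int" where
  "norm_one f = (\<Sum>m\<in>Poly_Mapping.keys f. \<bar>Poly_Mapping.lookup f m\<bar>)"

definition trace_poly :: "letter list \<Rightarrow> poly3" where
  "trace_poly w =
    (THE f. \<forall>A\<in>SL2. \<forall>B\<in>SL2.
      trace (word_eval A B w) = eval3 f (trace A) (trace B) (trace (A ** B)))"

end

theory Submission
  imports Defs
begin

text \<open>
  Every triple \<open>(x, y, z)\<close> of complex numbers of modulus at most \<open>r\<close>, where \<open>r \<ge> 1\<close>, is the trace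
  triple of a pair in \<open>SL(2)\<close> given by an upper and a lower triangular matrix whose squared
  Frobenius norms are at most \<open>(3 + sqrt 8) r\<^sup>2 \<le> (\<phi>\<^sub>0 r)\<^sup>2\<close>. Since the Frobenius norm is
  submultiplicative and invariant under inversion in \<open>SL(2)\<close>, a trace polynomial of a word of length
  \<open>n\<close> is at most \<open>2 (\<phi>\<^sub>0 r)\<^sup>n\<close> on the torus of radius \<open>r\<close>. By Parseval's identity the same holds for
  each coefficient times \<open>r\<close> to the power of its degree: \<open>r = 1\<close> bounds the coefficients and
  \<open>r \<longlonglongrightarrow> \<infinity>\<close> bounds the degree by \<open>n\<close>, hence the number of monomials.

  The polynomial of \<open>a\<^sup>n\<close> takes the value \<open>\<lambda>\<^sup>n + \<lambda>\<^sup>-\<^sup>n\<close> at \<open>x = \<lambda> + 1 / \<lambda>\<close>, and \<open>\<bar>\<lambda>\<bar> = \<phi>\<close> at \<open>x = \<i>\<close>.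
  Parseval's identity on an arc of length about \<open>1 / sqrt n\<close> around \<open>\<i>\<close> bounds the
  sum of the squared coefficients from below by a multiple of \<open>\<phi>\<^sup>2\<^sup>n / sqrt n\<close>; that sum is at most the
  product of the two norms, of which the \<open>\<ell>\<^sub>1\<close>-norm is at most \<open>2 \<phi>\<^sup>n\<close> by the recursion.
\<close>

section \<open>Cyclically reduced length\<close>

lemma carrier_F2: "w \<in> carrier F2 \<longleftrightarrow> reduced w"
  by (simp add: F2_def)

lemma one_F2: "\<one>\<^bsub>F2\<^esub> = []"
  by (simp add: F2_def)

lemma mult_F2: "u \<otimes>\<^bsub>F2\<^esub> v = foldr cons_reduce u v"
  by (simp add: F2_def)

lemma length_cons_reduce: "length (cons_reduce x w) \<le> Suc (length w)"
  by (cases w) auto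

lemma length_mult_F2: "length (u \<otimes>\<^bsub>F2\<^esub> v) \<le> length u + length v"
proof -
  have "length (foldr cons_reduce u v) \<le> length u + length v"
  proof (induction u)
    case (Cons x u)
    then show ?case
      using length_cons_reduce[of x "foldr cons_reduce u v"] by simp
  qed simp
  then show ?thesis by (simp add: mult_F2)
qed

lemma reduced_append:
  "reduced (u @ v) \<longleftrightarrow>
    reduced u \<and> reduced v \<and> (u \<noteq> [] \<and> v \<noteq> [] \<longrightarrow> hd v \<noteq> inv_letter (last u))"
proof (induction u rule: reduced.induct)
  case ("2_2" x)
  then show ?case by (cases v) auto
qed auto

lemma mult_F2_reduced: "reduced (u @ v) \<Longrightarrow> u \<otimes>\<^bsub>F2\<^esub> v = u @ v"
  unfolding mult_F2
proof (induction u)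
  case (Cons x u)
  then have "foldr cons_reduce u v = u @ v"
    by (auto dest: reduced_ConsD)
  with Cons.prems show ?case by (cases "u @ v") auto
qed simp

lemma inv_letter_eq_iff: "x = inv_letter y \<longleftrightarrow> y = inv_letter x"
  by auto

text \<open>The only new adjacency in a power is the last letter of \<open>u\<close> next to its
  first, and cyclic reducedness excludes cancellation there. The conjunct about last letters carries
  the induction.\<close>

lemma cyclically_reduced_power:
  assumes "cyclically_reduced u"
  shows "u [^]\<^bsub>F2\<^esub> (k::nat) = concat (replicate k u) \<and> reduced (concat (replicate k u))
    \<and> (k > 0 \<longrightarrow> u \<noteq> [] \<longrightarrow> concat (replicate k u) \<noteq> [] \<and> last (concat (replicate k u)) = last u)"
proof (induction k)
  case 0
  then show ?case by (simp add: nat_pow_def one_F2)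
next
  case (Suc k)
  interpret group F2 by (rule group_F2)
  have rep: "concat (replicate (Suc k) u) = concat (replicate k u) @ u"
    by (metis append_Nil2 concat.simps concat_append replicate_Suc replicate_append_same)
  have red: "reduced (concat (replicate k u) @ u)"
    unfolding reduced_append
    using Suc assms by (cases "k = 0") (auto simp: cyclically_reduced_def inv_letter_eq_iff[of "hd u"])
  have "u [^]\<^bsub>F2\<^esub> Suc k = u [^]\<^bsub>F2\<^esub> k \<otimes>\<^bsub>F2\<^esub> u"
    by simp
  then show ?case
    using Suc red by (auto simp only: rep mult_F2_reduced last_append if_False append_is_Nil_conv)
qed

lemma length_cyclically_reduced_power:
  assumes "cyclically_reduced u"
  shows "length (u [^]\<^bsub>F2\<^esub> (k::nat)) = k * length u"
  using cyclically_reduced_power[OF assms, of k]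
  by (simp add: length_concat sum_list_replicate)

lemma conjugate_F2_sym:
  assumes "conjugate_F2 u w" "w \<in> carrier F2"
  shows "conjugate_F2 w u"
proof -
  interpret group F2 by (rule group_F2)
  from assms obtain g where g: "g \<in> carrier F2" "u = g \<otimes>\<^bsub>F2\<^esub> w \<otimes>\<^bsub>F2\<^esub> inv\<^bsub>F2\<^esub> g"
    by (auto simp: conjugate_F2_def)
  then have "w = inv\<^bsub>F2\<^esub> g \<otimes>\<^bsub>F2\<^esub> u \<otimes>\<^bsub>F2\<^esub> inv\<^bsub>F2\<^esub> (inv\<^bsub>F2\<^esub> g)"
    using assms(2) by (simp add: m_assoc) (simp add: m_assoc[symmetric])
  with g(1) show ?thesis
    unfolding conjugate_F2_def using inv_closed by blast
qed

lemma conjugate_F2_trans: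
  assumes "conjugate_F2 u v" "conjugate_F2 v w" "w \<in> carrier F2"
  shows "conjugate_F2 u w"
proof -
  interpret group F2 by (rule group_F2)
  from assms obtain g h where g: "g \<in> carrier F2" "u = g \<otimes>\<^bsub>F2\<^esub> v \<otimes>\<^bsub>F2\<^esub> inv\<^bsub>F2\<^esub> g"
    and h: "h \<in> carrier F2" "v = h \<otimes>\<^bsub>F2\<^esub> w \<otimes>\<^bsub>F2\<^esub> inv\<^bsub>F2\<^esub> h"
    by (auto simp: conjugate_F2_def)
  then have "u = (g \<otimes>\<^bsub>F2\<^esub> h) \<otimes>\<^bsub>F2\<^esub> w \<otimes>\<^bsub>F2\<^esub> inv\<^bsub>F2\<^esub> (g \<otimes>\<^bsub>F2\<^esub> h)"
    using assms(3) by (simp add: m_assoc inv_mult_group)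
  with g h show ?thesis unfolding conjugate_F2_def by blast
qed

text \<open>Conjugation changes the length of every power by a bounded amount, whereas the length of
  the powers of a cyclically reduced word grows linearly.\<close>

lemma conjugate_cyclically_reduced_length_le:
  assumes "cyclically_reduced u" "cyclically_reduced v" "conjugate_F2 v u"
  shows "length v \<le> length u"
proof (rule ccontr)
  interpret group F2 by (rule group_F2)
  assume "\<not> length v \<le> length u"
  then have less: "length u + 1 \<le> length v" by simp
  from assms obtain g where g: "g \<in> carrier F2" "v = g \<otimes>\<^bsub>F2\<^esub> u \<otimes>\<^bsub>F2\<^esub> inv\<^bsub>F2\<^esub> g"
    by (auto simp: conjugate_F2_def)
  have u: "u \<in> carrier F2"
    using assms by (simp add: cyclically_reduced_def carrier_F2)
  have pow: "v [^]\<^bsub>F2\<^esub> k = g \<otimes>\<^bsub>F2\<^esub> (u [^]\<^bsub>F2\<^esub> k) \<otimes>\<^bsub>F2\<^esub> inv\<^bsub>F2\<^esub> g" for k :: nat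
  proof (induction k)
    case 0
    then show ?case using g by simp
  next
    case (Suc k)
    have cancel: "inv\<^bsub>F2\<^esub> g \<otimes>\<^bsub>F2\<^esub> (g \<otimes>\<^bsub>F2\<^esub> z) = z" if "z \<in> carrier F2" for z
      using g that by (simp add: m_assoc[symmetric])
    have "v [^]\<^bsub>F2\<^esub> Suc k = g \<otimes>\<^bsub>F2\<^esub> (u [^]\<^bsub>F2\<^esub> k) \<otimes>\<^bsub>F2\<^esub> (inv\<^bsub>F2\<^esub> g \<otimes>\<^bsub>F2\<^esub> g) \<otimes>\<^bsub>F2\<^esub> u \<otimes>\<^bsub>F2\<^esub> inv\<^bsub>F2\<^esub> g"
      using Suc g u by (simp add: m_assoc cancel)
    also have "\<dots> = g \<otimes>\<^bsub>F2\<^esub> (u [^]\<^bsub>F2\<^esub> Suc k) \<otimes>\<^bsub>F2\<^esub> inv\<^bsub>F2\<^esub> g"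
      using g u by (simp add: m_assoc cancel)
    finally show ?case .
  qed
  define L where "L = length g + length (inv\<^bsub>F2\<^esub> g)"
  have "k * length v \<le> k * length u + L" for k
  proof -
    have "k * length v = length (g \<otimes>\<^bsub>F2\<^esub> (u [^]\<^bsub>F2\<^esub> k) \<otimes>\<^bsub>F2\<^esub> inv\<^bsub>F2\<^esub> g)"
      using length_cyclically_reduced_power[OF assms(2), of k] pow[of k] by simp
    also have "\<dots> \<le> length g + length (u [^]\<^bsub>F2\<^esub> k) + length (inv\<^bsub>F2\<^esub> g)"
      by (meson add_mono_thms_linordered_semiring(3) length_mult_F2 order_trans)
    finally show ?thesis
      using length_cyclically_reduced_power[OF assms(1), of k] by (simp add: L_def)
  qed
  \<comment> \<open>By \<open>less\<close> the gap between \<open>k * length v\<close> and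
    \<open>k * length u\<close> is at least \<open>k\<close>, so \<open>k = L + 1\<close> already
    exceeds the constant \<open>L\<close>.\<close>
  from this[of "L + 1"] have "(L + 1) * length v \<le> (L + 1) * length u + L" .
  moreover have "(L + 1) * (length u + 1) \<le> (L + 1) * length v"
    using less by (intro mult_le_mono2)
  ultimately show False by (simp add: algebra_simps)
qed

text \<open>Induction on length: a reduced word that is not cyclically reduced begins with a letter
  and ends with its inverse, and stripping both is a conjugation to a shorter word.\<close>

lemma ex_cyclically_reduced_conjugate:
  assumes "reduced w"
  shows "\<exists>u. cyclically_reduced u \<and> conjugate_F2 u w"
  using assms
proof (induction w rule: length_induct)
  case (1 w)
  interpret group F2 by (rule group_F2)
  show ?case
  proof (cases "cyclically_reduced w")
    case True
    have "w \<in> carrier F2"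
      using 1 by (simp add: carrier_F2)
    then have "w = \<one>\<^bsub>F2\<^esub> \<otimes>\<^bsub>F2\<^esub> w \<otimes>\<^bsub>F2\<^esub> inv\<^bsub>F2\<^esub> \<one>\<^bsub>F2\<^esub>" by simp
    then have "conjugate_F2 w w"
      unfolding conjugate_F2_def by blast
    with True show ?thesis by blast
  next
    case False
    then have w: "w \<noteq> []" "last w = inv_letter (hd w)"
      using 1 by (auto simp: cyclically_reduced_def)
    then obtain x v where x: "w = x # v" by (cases w) auto
    \<comment> \<open>A one-letter word is impossible here, since no letter is its own
      inverse.\<close>
    with w have v: "v \<noteq> []" "last v = inv_letter x"
      by (auto split: if_splits)
    define u where "u = butlast v"
    have w_eq: "w = x # u @ [inv_letter x]"
      using v x append_butlast_last_id[of v] by (simp add: u_def)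
    have red: "reduced (x # u)" "reduced u" "reduced (u @ [inv_letter x])"
      using 1 w_eq reduced_append[of "x # u" "[inv_letter x]"] reduced_ConsD[of x] by auto
    have carr: "[x] \<in> carrier F2" "[inv_letter x] \<in> carrier F2" "u \<in> carrier F2" "w \<in> carrier F2"
      using red 1 by (auto simp: carrier_F2)
    have "[inv_letter x] \<otimes>\<^bsub>F2\<^esub> [x] = \<one>\<^bsub>F2\<^esub>"
      by (simp add: mult_F2 one_F2)
    then have inv: "inv\<^bsub>F2\<^esub> [x] = [inv_letter x]"
      using carr by (simp add: inv_equality)
    have "[x] \<otimes>\<^bsub>F2\<^esub> u = x # u"
      using red by (subst mult_F2_reduced) auto
    moreover have "(x # u) \<otimes>\<^bsub>F2\<^esub> [inv_letter x] = w"
      using 1 w_eq by (subst mult_F2_reduced) auto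
    ultimately have "w = [x] \<otimes>\<^bsub>F2\<^esub> u \<otimes>\<^bsub>F2\<^esub> inv\<^bsub>F2\<^esub> [x]"
      by (simp add: inv)
    then have "conjugate_F2 w u"
      using carr unfolding conjugate_F2_def by blast
    then have "conjugate_F2 u w"
      using carr conjugate_F2_sym by blast
    moreover have "length u < length w"
      by (simp add: w_eq)
    then obtain u' where "cyclically_reduced u'" "conjugate_F2 u' u"
      using 1 red(2) by blast
    ultimately show ?thesis
      using carr conjugate_F2_trans by blast
  qed
qed

text \<open>This justifies the definite description: two cyclically reduced conjugates of
  \<open>w\<close> are conjugate to each other, so the length inequality applies in both
  directions.\<close>

lemma cyclically_reduced_length:
  assumes "w \<in> carrier F2"
  obtains u where "cyclically_reduced u" "conjugate_F2 u w" "length u = cyclically_reduced_length w"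
proof -
  obtain u where u: "cyclically_reduced u" "conjugate_F2 u w"
    using ex_cyclically_reduced_conjugate assms by (auto simp: carrier_F2)
  have "cyclically_reduced_length w = length u"
    unfolding cyclically_reduced_length_def
  proof (rule the_equality)
    show "\<exists>u'. cyclically_reduced u' \<and> conjugate_F2 u' w \<and> length u' = length u"
      using u by blast
    fix n assume "\<exists>v. cyclically_reduced v \<and> conjugate_F2 v w \<and> length v = n"
    then obtain v where v: "cyclically_reduced v" "conjugate_F2 v w" "length v = n" by blast
    have "u \<in> carrier F2" "v \<in> carrier F2"
      using u v by (auto simp: carrier_F2 cyclically_reduced_def)
    then have "conjugate_F2 u v" "conjugate_F2 v u"
      using u v assms conjugate_F2_sym conjugate_F2_trans by blast+
    then have "length u = length v"
      using conjugate_cyclically_reduced_length_le u(1) v(1) by (meson le_antisym)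
    then show "n = length u" using v by simp
  qed
  with u that show thesis by metis
qed

section \<open>Evaluation of polynomials and Parseval's identity on tori\<close>

lemma eval3_superset:
  assumes "finite S" "Poly_Mapping.keys f \<subseteq> S"
  shows "eval3 f x y z = (\<Sum>(i, j, k)\<in>S. of_int (Poly_Mapping.lookup f (i, j, k)) * x ^ i * y ^ j * z ^ k)"
  unfolding eval3_def
  by (rule sum.mono_neutral_left) (use assms in \<open>auto simp: in_keys_iff\<close>)

lemma eval3_add: "eval3 (f + g) x y z = eval3 f x y z + eval3 g x y z"
proof -
  let ?S = "Poly_Mapping.keys f \<union> Poly_Mapping.keys g"
  have "eval3 h x y z = (\<Sum>(i, j, k)\<in>?S. of_int (Poly_Mapping.lookup h (i, j, k)) * x ^ i * y ^ j * z ^ k)"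
    if "h = f \<or> h = g \<or> h = f + g" for h
    using that keys_add[of f g] by (intro eval3_superset) auto
  then show ?thesis
    by (simp add: lookup_add algebra_simps split_def sum.distrib)
qed

lemma eval3_uminus: "eval3 (- f) x y z = - eval3 f x y z"
proof -
  have "Poly_Mapping.keys (- f) = Poly_Mapping.keys f"
    by (auto simp: in_keys_iff)
  then show ?thesis
    by (simp add: eval3_def split_def sum_negf)
qed

lemma eval3_diff: "eval3 (f - g) x y z = eval3 f x y z - eval3 g x y z"
  using eval3_add[of f "- g" x y z] by (simp add: eval3_uminus)

lemma eval3_single:
  "eval3 (Poly_Mapping.single (i, j, k) c) x y z = of_int c * x ^ i * y ^ j * z ^ k"
  by (simp add: eval3_def)

lemma eval3_zero: "eval3 0 x y z = 0"
  by (simp add: eval3_def)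

lemma eval3_sum: "eval3 (sum f I) x y z = (\<Sum>i\<in>I. eval3 (f i) x y z)"
  by (induction I rule: infinite_finite_induct) (auto simp: eval3_zero eval3_add)

lemma sum_single_keys:
  "(\<Sum>m\<in>Poly_Mapping.keys f. Poly_Mapping.single m (Poly_Mapping.lookup f m)) = f"
  by (rule poly_mapping_eqI)
    (auto simp: lookup_sum lookup_single when_def in_keys_iff sum.delta if_distrib cong: if_cong)

lemma single_mult_eq_sum:
  fixes f :: poly3
  shows "Poly_Mapping.single m c * f =
    (\<Sum>l\<in>Poly_Mapping.keys f. Poly_Mapping.single (m + l) (c * Poly_Mapping.lookup f l))"
  by (subst sum_single_keys[of f, symmetric]) (simp add: sum_distrib_left mult_single)

text \<open>By additivity in the left factor it suffices to multiply by a monomial, which merely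
  shifts exponents.\<close>

lemma eval3_mult: "eval3 (f * g) x y z = eval3 f x y z * eval3 g x y z"
proof -
  have mono: "eval3 (Poly_Mapping.single m c * g) x y z = eval3 (Poly_Mapping.single m c) x y z * eval3 g x y z"
    for m c
  proof (cases m)
    case (fields i j k)
    show ?thesis
      unfolding single_mult_eq_sum eval3_sum
      by (subst (2) eval3_def)
        (auto simp: fields eval3_single sum_distrib_left power_add mult_ac intro!: sum.cong)
  qed
  have "f * g = (\<Sum>m\<in>Poly_Mapping.keys f. Poly_Mapping.single m (Poly_Mapping.lookup f m) * g)"
    by (simp add: sum_distrib_right[symmetric] sum_single_keys)
  then have "eval3 (f * g) x y z =
      (\<Sum>m\<in>Poly_Mapping.keys f. eval3 (Poly_Mapping.single m (Poly_Mapping.lookup f m)) x y z) * eval3 g x y z"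
    by (simp add: eval3_sum mono sum_distrib_right)
  also have "\<dots> = eval3 f x y z * eval3 g x y z"
    by (simp add: eval3_sum[symmetric] sum_single_keys)
  finally show ?thesis .
qed

lemma eval3_of_int: "eval3 (of_int c) x y z = of_int c"
  using eval3_single[of 0 0 0 c x y z] single_of_int[of c, where ?'b = int and ?'a = "nat \<times> nat \<times> nat"]
  by (simp flip: zero_prod_def)

lemma eval3_one: "eval3 1 x y z = 1"
  using eval3_of_int[of 1] by simp

lemma eval3_numeral: "eval3 (numeral n) x y z = numeral n"
  using eval3_of_int[of "numeral n"] by simp

definition deg3 :: "nat \<times> nat \<times> nat \<Rightarrow> nat" where
  "deg3 m = fst m + fst (snd m) + snd (snd m)"

lemma deg3_simp [simp]: "deg3 (i, j, k) = i + j + k"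
  by (simp add: deg3_def)

text \<open>Used both as a range of exponents and as the index set of the grid points at which a
  polynomial is sampled.\<close>

definition box3 :: "nat \<Rightarrow> (nat \<times> nat \<times> nat) set" where
  "box3 N = {..<N} \<times> {..<N} \<times> {..<N}"

text \<open>The threshold form leaves \<open>N\<close> free, so that a multiple of four can be
  chosen later.\<close>

lemma ex_box3: "\<exists>M>0. \<forall>N\<ge>M. Poly_Mapping.keys f \<subseteq> box3 N"
proof (intro exI conjI allI impI subsetI)
  let ?M = "Suc (\<Sum>m\<in>Poly_Mapping.keys f. deg3 m)"
  show "?M > 0" by simp
  fix N m assume N: "?M \<le> N" and m: "m \<in> Poly_Mapping.keys f"
  have "deg3 m \<le> (\<Sum>m\<in>Poly_Mapping.keys f. deg3 m)"
    using m by (intro member_le_sum) auto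
  with N show "m \<in> box3 N"
    by (cases m) (auto simp: box3_def)
qed

section \<open>Discrete Parseval identity on grids of roots of unity\<close>

lemma parseval_finite:
  fixes \<psi> :: "'p \<Rightarrow> 'm \<Rightarrow> complex"
  assumes "finite K"
    and orth: "\<And>m m'. m \<in> K \<Longrightarrow> m' \<in> K \<Longrightarrow>
      (\<Sum>p\<in>P. \<psi> p m * cnj (\<psi> p m')) = (if m = m' then of_real T else 0)"
  shows "(\<Sum>p\<in>P. (cmod (\<Sum>m\<in>K. e m * \<psi> p m))\<^sup>2) = T * (\<Sum>m\<in>K. (cmod (e m))\<^sup>2)"
proof -
  have "complex_of_real (\<Sum>p\<in>P. (cmod (\<Sum>m\<in>K. e m * \<psi> p m))\<^sup>2) =
      (\<Sum>p\<in>P. (\<Sum>m\<in>K. e m * \<psi> p m) * cnj (\<Sum>m\<in>K. e m * \<psi> p m))"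
    by (simp only: of_real_sum complex_norm_square)
  also have "\<dots> = (\<Sum>p\<in>P. \<Sum>m\<in>K. \<Sum>m'\<in>K. e m * cnj (e m') * (\<psi> p m * cnj (\<psi> p m')))"
    by (simp add: sum_product mult_ac)
  also have "\<dots> = (\<Sum>m\<in>K. \<Sum>m'\<in>K. \<Sum>p\<in>P. e m * cnj (e m') * (\<psi> p m * cnj (\<psi> p m')))"
    by (subst sum.swap, intro sum.cong refl, subst sum.swap) auto
  also have "\<dots> = (\<Sum>m\<in>K. \<Sum>m'\<in>K. if m = m' then e m * cnj (e m') * of_real T else 0)"
    by (intro sum.cong refl) (simp add: sum_distrib_left[symmetric] orth)
  also have "\<dots> = (\<Sum>m\<in>K. of_real T * (e m * cnj (e m)))"
    using assms(1) by (simp add: mult_ac)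
  also have "\<dots> = complex_of_real (T * (\<Sum>m\<in>K. (cmod (e m))\<^sup>2))"
    by (simp only: complex_norm_square of_real_mult of_real_sum sum_distrib_left)
  finally show ?thesis by (simp only: of_real_eq_iff)
qed

text \<open>Averaging over these points replaces integration over the circle; it is exact for
  exponents below \<open>N\<close>.\<close>

definition root_unity :: "nat \<Rightarrow> nat \<Rightarrow> complex" where
  "root_unity N a = cis (2 * pi * real a / real N)"

lemma norm_root_unity [simp]: "cmod (root_unity N a) = 1"
  by (simp add: root_unity_def)

text \<open>The sum is geometric with ratio \<open>w\<close>, where \<open>w ^ N = 1\<close>; for
  distinct exponents \<open>w = 1\<close> would make \<open>N\<close> divide a nonzero integer of
  modulus less than \<open>N\<close>.\<close>

lemma root_unity_orthogonal:
  assumes "i < N" "j < N"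
  shows "(\<Sum>a<N. root_unity N a ^ i * cnj (root_unity N a ^ j)) = (if i = j then of_nat N else 0)"
proof -
  define w where "w = cis (2 * pi * (real i - real j) / real N)"
  have N: "N > 0" using assms by simp
  have "root_unity N a ^ i * cnj (root_unity N a ^ j) = w ^ a" for a
    by (simp add: root_unity_def w_def Complex.DeMoivre cis_cnj cis_mult field_simps diff_divide_distrib)
  then have eq: "(\<Sum>a<N. root_unity N a ^ i * cnj (root_unity N a ^ j)) = (\<Sum>a<N. w ^ a)"
    by simp
  show ?thesis
  proof (cases "i = j")
    case True
    then show ?thesis unfolding eq by (simp add: w_def)
  next
    case False
    have "w \<noteq> 1"
    proof
      assume "w = 1"
      then have "cos (2 * pi * (real i - real j) / real N) = 1"
        by (simp add: w_def complex_eq_iff)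
      then obtain k :: int where k: "2 * pi * (real i - real j) / real N = of_int k * 2 * pi"
        by (auto simp: cos_one_2pi_int)
      then have "2 * pi * (real i - real j) = 2 * pi * (of_int k * real N)"
        using N by (simp add: field_simps)
      then have "real i - real j = of_int k * real N"
        by (metis mult_cancel_left pi_neq_zero mult_eq_0_iff zero_neq_numeral)
      then have "real_of_int (int i - int j) = real_of_int (k * int N)" by simp
      then have *: "int i - int j = k * int N" by (simp only: of_int_eq_iff)
      then have "int N dvd int i - int j"
        by (metis dvd_triv_right)
      moreover have "\<bar>int i - int j\<bar> < int N" using assms by linarith
      ultimately have "int i - int j = 0"
        by (metis dvd_imp_le_int abs_of_nat not_le)
      with False show False by simp
    qed
    moreover have "w ^ N = 1"
    proof -
      have "w ^ N = cis (2 * pi * of_int (int i - int j))"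
        using N by (simp add: w_def Complex.DeMoivre)
      then show ?thesis by (simp add: cis_multiple_2pi)
    qed
    ultimately show ?thesis
      unfolding eq using False geometric_sum[of w N] by simp
  qed
qed

text \<open>The radius is absorbed into the coefficients \<open>e m\<close>, and the orthogonality
  sums factor over the three coordinates.\<close>

lemma parseval3:
  assumes "Poly_Mapping.keys f \<subseteq> box3 N"
  shows "(\<Sum>(a, b, c)\<in>box3 N. (cmod (eval3 f (of_real r * root_unity N a) (of_real r * root_unity N b)
      (of_real r * root_unity N c)))\<^sup>2) =
    real N ^ 3 * (\<Sum>m\<in>Poly_Mapping.keys f. (real_of_int (Poly_Mapping.lookup f m) * r ^ deg3 m)\<^sup>2)"
proof -
  define \<psi> :: "nat \<times> nat \<times> nat \<Rightarrow> nat \<times> nat \<times> nat \<Rightarrow> complex" where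
    "\<psi> = (\<lambda>(a, b, c) (i, j, k). root_unity N a ^ i * (root_unity N b ^ j * root_unity N c ^ k))"
  define e where "e m = complex_of_real (real_of_int (Poly_Mapping.lookup f m) * r ^ deg3 m)" for m
  have eval: "eval3 f (of_real r * root_unity N a) (of_real r * root_unity N b) (of_real r * root_unity N c) =
    (\<Sum>m\<in>Poly_Mapping.keys f. e m * \<psi> (a, b, c) m)" for a b c
    unfolding eval3_def
    by (intro sum.cong refl) (auto simp: e_def \<psi>_def power_mult_distrib power_add mult_ac)
  have orth: "(\<Sum>p\<in>box3 N. \<psi> p m * cnj (\<psi> p m')) = (if m = m' then of_real (real N ^ 3) else 0)"
    if mm: "m \<in> Poly_Mapping.keys f" "m' \<in> Poly_Mapping.keys f" for m m'
  proof -
    obtain i j k i' j' k' where m: "m = (i, j, k)" "m' = (i', j', k')"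
      by (metis prod_cases3)
    have lt: "i < N" "j < N" "k < N" "i' < N" "j' < N" "k' < N"
      using mm assms by (auto simp: m box3_def)
    define h where "h i i' a = root_unity N a ^ i * cnj (root_unity N a ^ i')" for i i' a
    have "(\<Sum>p\<in>box3 N. \<psi> p m * cnj (\<psi> p m')) =
        (\<Sum>(a, b, c)\<in>box3 N. h i i' a * (h j j' b * h k k' c))"
      by (intro sum.cong refl) (auto simp: m \<psi>_def h_def mult_ac)
    also have "\<dots> = (\<Sum>a<N. h i i' a) * ((\<Sum>b<N. h j j' b) * (\<Sum>c<N. h k k' c))"
      unfolding box3_def sum.cartesian_product[symmetric]
      by (simp only: sum_distrib_left[symmetric] sum_distrib_right[symmetric])
    also have "\<dots> = (if m = m' then of_real (real N ^ 3) else 0)"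
      unfolding h_def root_unity_orthogonal[OF lt(1,4)] root_unity_orthogonal[OF lt(2,5)]
        root_unity_orthogonal[OF lt(3,6)]
      by (simp add: m power3_eq_cube)
    finally show ?thesis .
  qed
  have "(\<Sum>p\<in>box3 N. (cmod (\<Sum>m\<in>Poly_Mapping.keys f. e m * \<psi> p m))\<^sup>2) =
      real N ^ 3 * (\<Sum>m\<in>Poly_Mapping.keys f. (cmod (e m))\<^sup>2)"
    by (rule parseval_finite) (use orth in auto)
  also have "(\<lambda>p. (cmod (\<Sum>m\<in>Poly_Mapping.keys f. e m * \<psi> p m))\<^sup>2) =
    (\<lambda>(a, b, c). (cmod (eval3 f (of_real r * root_unity N a) (of_real r * root_unity N b)
      (of_real r * root_unity N c)))\<^sup>2)"
    by (auto simp: eval fun_eq_iff)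
  also have "(\<lambda>m. (cmod (e m))\<^sup>2) = (\<lambda>m. (real_of_int (Poly_Mapping.lookup f m) * r ^ deg3 m)\<^sup>2)"
    unfolding e_def norm_of_real power2_abs ..
  finally show ?thesis .
qed

text \<open>A single term of the Parseval sum is at most the mean of the squared modulus over the
  grid, hence at most \<open>M\<^sup>2\<close>.\<close>

lemma coeff_bound_torus:
  assumes r: "r \<ge> 0"
    and bound: "\<And>x y z. cmod x = r \<Longrightarrow> cmod y = r \<Longrightarrow> cmod z = r \<Longrightarrow> cmod (eval3 f x y z) \<le> M"
  shows "\<bar>real_of_int (Poly_Mapping.lookup f m)\<bar> * r ^ deg3 m \<le> M"
proof -
  have "cmod (eval3 f (of_real r) (of_real r) (of_real r)) \<le> M"
    using r by (intro bound) auto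
  then have M: "M \<ge> 0"
    using norm_ge_zero order_trans by blast
  obtain N where N: "N > 0" "Poly_Mapping.keys f \<subseteq> box3 N"
    using ex_box3 by blast
  show ?thesis
  proof (cases "m \<in> Poly_Mapping.keys f")
    case True
    have "real N ^ 3 * (real_of_int (Poly_Mapping.lookup f m) * r ^ deg3 m)\<^sup>2 \<le>
        real N ^ 3 * (\<Sum>m\<in>Poly_Mapping.keys f. (real_of_int (Poly_Mapping.lookup f m) * r ^ deg3 m)\<^sup>2)"
      using True
      by (intro mult_left_mono member_le_sum[where f = "\<lambda>m. (real_of_int (Poly_Mapping.lookup f m) * r ^ deg3 m)\<^sup>2"]) auto
    also have "\<dots> \<le> (\<Sum>p\<in>box3 N. M\<^sup>2)"
      unfolding parseval3[OF N(2), symmetric]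
      using r by (intro sum_mono) (auto intro!: power_mono bound simp: norm_mult)
    also have "\<dots> = real N ^ 3 * M\<^sup>2"
      by (simp add: box3_def card_cartesian_product power3_eq_cube)
    finally have "(real_of_int (Poly_Mapping.lookup f m) * r ^ deg3 m)\<^sup>2 \<le> M\<^sup>2"
      using N by simp
    then have "\<bar>real_of_int (Poly_Mapping.lookup f m) * r ^ deg3 m\<bar> \<le> M"
      using M by (simp add: abs_le_square_iff[symmetric])
    then show ?thesis using r by (simp add: abs_mult)
  next
    case False
    then show ?thesis using M by (simp add: in_keys_iff)
  qed
qed

text \<open>Apply the coefficient bound to \<open>f - g\<close> on the unit torus with bound
  zero.\<close>

lemma eval3_inject:
  assumes "\<And>x y z. eval3 f x y z = eval3 g x y z"
  shows "f = g"
proof (rule poly_mapping_eqI)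
  fix m
  have "\<bar>real_of_int (Poly_Mapping.lookup (f - g) m)\<bar> * 1 ^ deg3 m \<le> 0"
    by (rule coeff_bound_torus) (simp_all add: assms eval3_diff)
  then show "Poly_Mapping.lookup f m = Poly_Mapping.lookup g m"
    by (simp add: lookup_minus)
qed

section \<open>Norms of polynomials\<close>

text \<open>Makes \<open>Max\<close> in \<open>norm_inf\<close> a genuine maximum.\<close>

lemma finite_range_lookup: "finite (range (\<lambda>m. \<bar>Poly_Mapping.lookup f m\<bar>))"
  for f :: poly3
proof (rule finite_subset)
  show "range (\<lambda>m. \<bar>Poly_Mapping.lookup f m\<bar>) \<subseteq> insert 0 ((\<lambda>m. \<bar>Poly_Mapping.lookup f m\<bar>) ` Poly_Mapping.keys f)"
    by (auto simp: in_keys_iff)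
qed simp

lemma lookup_le_norm_inf: "\<bar>Poly_Mapping.lookup f m\<bar> \<le> norm_inf f"
  unfolding norm_inf_def by (rule Max_ge[OF finite_range_lookup]) auto

lemma norm_inf_attained: "\<exists>m. norm_inf f = \<bar>Poly_Mapping.lookup f m\<bar>"
  using Max_in[OF finite_range_lookup[of f]] unfolding norm_inf_def by blast

lemma norm_one_superset:
  assumes "finite S" "Poly_Mapping.keys f \<subseteq> S"
  shows "norm_one f = (\<Sum>m\<in>S. \<bar>Poly_Mapping.lookup f m\<bar>)"
  unfolding norm_one_def
  by (rule sum.mono_neutral_left) (use assms in \<open>auto simp: in_keys_iff\<close>)

lemma norm_one_add_le: "norm_one (f + g) \<le> norm_one f + norm_one g"
proof -
  let ?S = "Poly_Mapping.keys f \<union> Poly_Mapping.keys g"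
  have "norm_one h = (\<Sum>m\<in>?S. \<bar>Poly_Mapping.lookup h m\<bar>)" if "h = f \<or> h = g \<or> h = f + g" for h
    using that keys_add[of f g] by (intro norm_one_superset) auto
  then show ?thesis
    by (simp add: lookup_add sum.distrib[symmetric] sum_mono)
qed

lemma norm_one_uminus: "norm_one (- f) = norm_one f"
proof -
  have "Poly_Mapping.keys (- f) = Poly_Mapping.keys f"
    by (auto simp: in_keys_iff)
  then show ?thesis by (simp add: norm_one_def)
qed

lemma norm_one_diff_le: "norm_one (f - g) \<le> norm_one f + norm_one g"
  using norm_one_add_le[of f "- g"] by (simp add: norm_one_uminus)

lemma norm_one_sum_le: "norm_one (sum f I) \<le> (\<Sum>i\<in>I. norm_one (f i))"
proof (induction I rule: infinite_finite_induct)
  case (insert i I)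
  then show ?case using norm_one_add_le[of "f i" "sum f I"] by simp
qed (auto simp: norm_one_def)

lemma norm_one_single: "norm_one (Poly_Mapping.single m c) = \<bar>c\<bar>"
  by (simp add: norm_one_def)

lemma norm_one_monomial_mult_le: "norm_one (Poly_Mapping.single m c * f) \<le> \<bar>c\<bar> * norm_one f"
proof -
  have "norm_one (Poly_Mapping.single m c * f) \<le>
      (\<Sum>l\<in>Poly_Mapping.keys f. norm_one (Poly_Mapping.single (m + l) (c * Poly_Mapping.lookup f l)))"
    unfolding single_mult_eq_sum by (rule norm_one_sum_le)
  also have "\<dots> = \<bar>c\<bar> * norm_one f"
    unfolding norm_one_single by (simp add: norm_one_def abs_mult sum_distrib_left)
  finally show ?thesis .
qed

lemma norm_eval3_le_norm_one:
  assumes "cmod x \<le> 1" "cmod y \<le> 1" "cmod z \<le> 1"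
  shows "cmod (eval3 f x y z) \<le> real_of_int (norm_one f)"
proof -
  have "cmod (eval3 f x y z) \<le> (\<Sum>m\<in>Poly_Mapping.keys f. real_of_int \<bar>Poly_Mapping.lookup f m\<bar>)"
    unfolding eval3_def
  proof (intro sum_norm_le)
    fix m :: "nat \<times> nat \<times> nat"
    obtain i j k where m: "m = (i, j, k)" by (cases m)
    have "cmod (of_int (Poly_Mapping.lookup f m)) * (cmod x ^ i * (cmod y ^ j * cmod z ^ k)) \<le>
        real_of_int \<bar>Poly_Mapping.lookup f m\<bar> * (1 * (1 * 1))"
      using assms by (intro mult_mono power_le_one) auto
    then show "cmod (case m of (i, j, k) \<Rightarrow> of_int (Poly_Mapping.lookup f (i, j, k)) * x ^ i * y ^ j * z ^ k)
        \<le> real_of_int \<bar>Poly_Mapping.lookup f m\<bar>"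
      by (simp add: m norm_mult norm_power mult_ac)
  qed
  then show ?thesis by (simp add: norm_one_def)
qed

text \<open>A slack variable turns an exponent triple of degree at most \<open>n\<close> into four
  naturals with sum \<open>n\<close>, which are counted by stars and bars.\<close>

lemma card_deg3_le: "finite {m. deg3 m \<le> n} \<and> card {m. deg3 m \<le> n} \<le> (n + 3) choose 3"
proof -
  let ?L = "{l :: nat list. length l = 4 \<and> sum_list l = n}"
  let ?g = "\<lambda>(i, j, k). [i, j, k, n - (i + j + k)]"
  have card: "card ?L = (n + 3) choose 3"
    using card_length_sum_list[of 4 n] binomial_symmetric[of 3 "n + 3"] by (simp add: add.commute[of n 3])
  \<comment> \<open>An infinite set has \<open>card\<close> zero, so positivity yields
    finiteness.\<close>
  then have "card ?L > 0" by (simp only: zero_less_binomial_iff)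
  then have fin: "finite ?L" by (rule card_ge_0_finite)
  have inj: "inj_on ?g {m. deg3 m \<le> n}"
    by (auto simp: inj_on_def)
  have sub: "?g ` {m. deg3 m \<le> n} \<subseteq> ?L"
    by auto
  show ?thesis
    using card_inj_on_le[OF inj sub fin] card inj_on_finite[OF inj sub fin] by simp
qed

lemma norm_one_le_deg:
  assumes "\<And>m. Poly_Mapping.lookup f m \<noteq> 0 \<Longrightarrow> deg3 m \<le> n"
  shows "norm_one f \<le> int ((n + 3) choose 3) * norm_inf f"
proof -
  let ?D = "{m. deg3 m \<le> n}"
  have "norm_one f = (\<Sum>m\<in>?D. \<bar>Poly_Mapping.lookup f m\<bar>)"
    using assms card_deg3_le[of n] by (intro norm_one_superset) (auto simp: in_keys_iff)
  also have "\<dots> \<le> int (card ?D) * norm_inf f"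
    by (rule sum_bounded_above) (rule lookup_le_norm_inf)
  also have "\<dots> \<le> int ((n + 3) choose 3) * norm_inf f"
    using card_deg3_le[of n] lookup_le_norm_inf[of f 0]
    by (intro mult_right_mono) linarith+
  finally show ?thesis .
qed

section \<open>Existence of trace polynomials\<close>

lemmas matrix_2_simps = vec_eq_iff forall_2 sum_2 matrix_matrix_mult_def mat_def det_2 trace_def

lemma SL2_D: "A \<in> SL2 \<Longrightarrow> A $ 1 $ 1 * A $ 2 $ 2 - A $ 1 $ 2 * A $ 2 $ 1 = 1"
  by (simp add: SL2_def det_2)

text \<open>The adjugate, which gives explicit entries for the inverse of a matrix of determinant
  1.\<close>

definition adj2 :: "complex^2^2 \<Rightarrow> complex^2^2" where
  "adj2 A = vector [vector [A $ 2 $ 2, - A $ 1 $ 2], vector [- A $ 2 $ 1, A $ 1 $ 1]]"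

lemma adj2_simps [simp]:
  "adj2 A $ 1 $ 1 = A $ 2 $ 2" "adj2 A $ 1 $ 2 = - A $ 1 $ 2"
  "adj2 A $ 2 $ 1 = - A $ 2 $ 1" "adj2 A $ 2 $ 2 = A $ 1 $ 1"
  by (simp_all add: adj2_def vector_2)

lemma matrix_inv_SL2:
  assumes "A \<in> SL2"
  shows "matrix_inv A = adj2 A"
proof -
  have "invertible A"
    using assms by (auto simp: SL2_def invertible_det_nz)
  then have inv: "A ** matrix_inv A = mat 1 \<and> matrix_inv A ** A = mat 1"
    unfolding invertible_def matrix_inv_def by - (erule someI_ex)
  have "A ** adj2 A = mat 1"
    using SL2_D[OF assms] by (simp add: matrix_2_simps algebra_simps)
  then have "matrix_inv A ** (A ** adj2 A) = matrix_inv A"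
    by simp
  with inv show ?thesis by (simp add: matrix_mul_assoc)
qed

text \<open>By Cayley-Hamilton and its polarization
  \<open>A B + B A = tr(A) B + tr(B) A + tr(A B) - tr(A) tr(B)\<close>, the span of \<open>1, A, B, A B\<close> over the
  polynomials in the three traces is stable under left multiplication by \<open>A\<close>, \<open>B\<close> and their inverses.\<close>

definition basis_comb :: "complex^2^2 \<Rightarrow> complex^2^2 \<Rightarrow> complex \<Rightarrow> complex \<Rightarrow> complex \<Rightarrow> complex \<Rightarrow> complex^2^2" where
  "basis_comb A B p q r s = (\<chi> i j. p * mat 1 $ i $ j + q * A $ i $ j + r * B $ i $ j + s * (A ** B) $ i $ j)"

text \<open>Cayley-Hamilton with determinant 1. The free right factor \<open>M\<close> and the
  entrywise form let it rewrite inside longer products.\<close>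

lemma SL2_square_mult:
  assumes "A \<in> SL2"
  shows "(A ** (A ** M)) $ i $ j = trace A * (A ** M) $ i $ j - (M :: complex^2^2) $ i $ j"
proof -
  have "M $ k $ j = (A $ 1 $ 1 * A $ 2 $ 2 - A $ 1 $ 2 * A $ 2 $ 1) * M $ k $ j" for k
    using SL2_D[OF assms] by simp
  from this[of 1] this[of 2] show ?thesis
    using exhaust_2[of i] by (auto simp: matrix_matrix_mult_def sum_2 trace_def algebra_simps)
qed

lemma polarized_Cayley_Hamilton_mult:
  fixes A B M :: "complex^2^2"
  shows "(B ** (A ** M)) $ i $ j = trace A * (B ** M) $ i $ j + trace B * (A ** M) $ i $ j
    + (trace (A ** B) - trace A * trace B) * M $ i $ j - (A ** (B ** M)) $ i $ j"
  using exhaust_2[of i] by (auto simp: matrix_matrix_mult_def sum_2 trace_def algebra_simps)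

lemma mult_basis_comb:
  fixes M :: "complex^2^2"
  shows "(M ** basis_comb A B p q r s) $ i $ j =
    p * M $ i $ j + q * (M ** A) $ i $ j + r * (M ** B) $ i $ j + s * (M ** (A ** B)) $ i $ j"
  using exhaust_2[of i] exhaust_2[of j]
  by (auto simp: basis_comb_def mat_def matrix_matrix_mult_def sum_2 algebra_simps)

text \<open>Read off from the products \<open>A A = x A - 1\<close>, \<open>B B = y B - 1\<close>,
  \<open>B A = x B + y A + (z - x y) - A B\<close> and \<open>B A B = A + z B - x\<close>.\<close>

lemma basis_comb_left_mult:
  assumes "A \<in> SL2" "B \<in> SL2"
  defines "x \<equiv> trace A" and "y \<equiv> trace B" and "z \<equiv> trace (A ** B)"
  shows "A ** basis_comb A B p q r s = basis_comb A B (- q) (p + x * q) (- s) (r + x * s)"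
    and "B ** basis_comb A B p q r s =
      basis_comb A B ((z - x * y) * q - r - x * s) (y * q + s) (p + x * q + y * r + z * s) (- q)"
proof -
  note A2 = SL2_square_mult[OF assms(1)] SL2_square_mult[OF assms(1), of "mat 1", simplified]
  note B2 = SL2_square_mult[OF assms(2)] SL2_square_mult[OF assms(2), of "mat 1", simplified]
  have BA: "(B ** A) $ i $ j = x * B $ i $ j + y * A $ i $ j + (z - x * y) * mat 1 $ i $ j - (A ** B) $ i $ j" for i j
    using polarized_Cayley_Hamilton_mult[of B A "mat 1" i j] by (simp add: x_def y_def z_def)
  have "B ** B = basis_comb A B (- 1) 0 y 0"
    by (simp add: vec_eq_iff basis_comb_def B2(2) y_def)
  then have "(A ** (B ** B)) $ i $ j = y * (A ** B) $ i $ j - A $ i $ j" for i j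
    by (simp add: mult_basis_comb)
  \<comment> \<open>Polarization multiplied on the right by \<open>B\<close>; the squares of
    \<open>B\<close> are then eliminated by Cayley-Hamilton.\<close>
  then have BAB: "(B ** (A ** B)) $ i $ j = A $ i $ j + z * B $ i $ j - x * mat 1 $ i $ j" for i j
    using polarized_Cayley_Hamilton_mult[of B A B i j] B2(2)[of i j]
    unfolding x_def y_def z_def
    by (simp add: \<open>\<And>i j. (A ** (B ** B)) $ i $ j = y * (A ** B) $ i $ j - A $ i $ j\<close> y_def) (simp add: algebra_simps)
  show "A ** basis_comb A B p q r s = basis_comb A B (- q) (p + x * q) (- s) (r + x * s)"
    by (simp add: vec_eq_iff mult_basis_comb A2 x_def) (simp add: basis_comb_def algebra_simps)
  show "B ** basis_comb A B p q r s =
      basis_comb A B ((z - x * y) * q - r - x * s) (y * q + s) (p + x * q + y * r + z * s) (- q)"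
    by (simp add: vec_eq_iff mult_basis_comb BA BAB B2(2))
      (simp add: basis_comb_def y_def[symmetric] algebra_simps)
qed

text \<open>Cayley-Hamilton in the form \<open>A\<^sup>-\<^sup>1 = tr(A) - A\<close> reduces inverse
  letters to positive ones.\<close>

lemma inverse_left_mult:
  fixes M :: "complex^2^2"
  assumes "A \<in> SL2"
  shows "(matrix_inv A ** M) $ i $ j = trace A * M $ i $ j - (A ** M) $ i $ j"
  using exhaust_2[of i] exhaust_2[of j]
  by (auto simp: matrix_inv_SL2[OF assms] matrix_2_simps algebra_simps)

lemma word_eval_Nil [simp]: "word_eval A B [] = mat 1"
  by (simp add: word_eval_def)

lemma word_eval_Cons [simp]: "word_eval A B (l # w) = letter_eval A B l ** word_eval A B w"
  by (simp add: word_eval_def)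

definition trace_eval :: "poly3 \<Rightarrow> complex^2^2 \<Rightarrow> complex^2^2 \<Rightarrow> complex" where
  "trace_eval f A B = eval3 f (trace A) (trace B) (trace (A ** B))"

lemma trace_eval_simps [simp]:
  "trace_eval (f + g) A B = trace_eval f A B + trace_eval g A B"
  "trace_eval (f - g) A B = trace_eval f A B - trace_eval g A B"
  "trace_eval (f * g) A B = trace_eval f A B * trace_eval g A B"
  "trace_eval (- f) A B = - trace_eval f A B"
  "trace_eval 0 A B = 0" "trace_eval 1 A B = 1" "trace_eval (numeral n) A B = numeral n"
  by (simp_all add: trace_eval_def eval3_add eval3_diff eval3_mult eval3_uminus eval3_zero
      eval3_one eval3_numeral)

definition "poly_x = (Poly_Mapping.single (1, 0, 0) 1 :: poly3)"
definition "poly_y = (Poly_Mapping.single (0, 1, 0) 1 :: poly3)"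
definition "poly_z = (Poly_Mapping.single (0, 0, 1) 1 :: poly3)"

lemma trace_eval_vars [simp]:
  "trace_eval poly_x A B = trace A" "trace_eval poly_y A B = trace B"
  "trace_eval poly_z A B = trace (A ** B)"
  by (simp_all add: trace_eval_def poly_x_def poly_y_def poly_z_def eval3_single)

text \<open>Induction on the word. The four polynomials are chosen before \<open>A\<close> and
  \<open>B\<close>, so they depend on the word alone.\<close>

lemma ex_word_eval_basis:
  "\<exists>p q r s. \<forall>A\<in>SL2. \<forall>B\<in>SL2. word_eval A B w =
    basis_comb A B (trace_eval p A B) (trace_eval q A B) (trace_eval r A B) (trace_eval s A B)"
proof (induction w)
  case Nil
  show ?case
    by (rule exI[of _ 1], rule exI[of _ 0], rule exI[of _ 0], rule exI[of _ 0])
      (simp add: basis_comb_def vec_eq_iff)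
next
  case (Cons l w)
  then obtain p q r s where IH: "\<And>A B. A \<in> SL2 \<Longrightarrow> B \<in> SL2 \<Longrightarrow> word_eval A B w =
    basis_comb A B (trace_eval p A B) (trace_eval q A B) (trace_eval r A B) (trace_eval s A B)"
    by blast
  obtain g e where l: "l = (g, e)" by (cases l)
  have step: ?case if "\<And>A B. A \<in> SL2 \<Longrightarrow> B \<in> SL2 \<Longrightarrow> letter_eval A B l ** word_eval A B w =
    basis_comb A B (trace_eval p' A B) (trace_eval q' A B) (trace_eval r' A B) (trace_eval s' A B)"
    for p' q' r' s'
    using that unfolding word_eval_Cons by blast
  note comb = basis_comb_left_mult
  let ?x = poly_x and ?y = poly_y and ?z = poly_z
  show ?case
  proof (cases g; cases e)
    assume "g = Gen_a" "e"
    then show ?thesis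
      by (intro step[of "- q" "p + ?x * q" "- s" "r + ?x * s"])
        (simp add: l letter_eval_def IH comb)
  next
    assume "g = Gen_b" "e"
    then show ?thesis
      by (intro step[of "(?z - ?x * ?y) * q - r - ?x * s" "?y * q + s" "p + ?x * q + ?y * r + ?z * s" "- q"])
        (simp add: l letter_eval_def IH comb)
  next
    \<comment> \<open>For an inverse letter each new coefficient is the trace of the generator times
      the old one, minus the one produced by the positive letter.\<close>
    assume "g = Gen_a" "\<not> e"
    then show ?thesis
      by (intro step[of "?x * p + q" "- p" "?x * r + s" "- r"])
        (simp add: l letter_eval_def IH comb vec_eq_iff inverse_left_mult,
          simp add: basis_comb_def algebra_simps)
  next
    assume "g = Gen_b" "\<not> e"
    then show ?thesis
      by (intro step[of "?y * p - ((?z - ?x * ?y) * q - r - ?x * s)" "- s"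
            "- p - ?x * q - ?z * s" "q + ?y * s"])
        (simp add: l letter_eval_def IH comb vec_eq_iff inverse_left_mult,
          simp add: basis_comb_def algebra_simps)
  qed
qed

lemma trace_basis_comb:
  "trace (basis_comb A B p q r s) = 2 * p + trace A * q + trace B * r + trace (A ** B) * s"
  by (simp add: basis_comb_def matrix_2_simps algebra_simps)

text \<open>Take traces in the basis expansion: \<open>1, A, B, A B\<close> have traces
  \<open>2, x, y, z\<close>.\<close>

lemma ex_trace_poly:
  "\<exists>f. \<forall>A\<in>SL2. \<forall>B\<in>SL2. trace (word_eval A B w) = trace_eval f A B"
proof -
  obtain p q r s where *: "\<And>A B. A \<in> SL2 \<Longrightarrow> B \<in> SL2 \<Longrightarrow> word_eval A B w =
    basis_comb A B (trace_eval p A B) (trace_eval q A B) (trace_eval r A B) (trace_eval s A B)"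
    using ex_word_eval_basis by blast
  then have "\<forall>A\<in>SL2. \<forall>B\<in>SL2. trace (word_eval A B w) =
      trace_eval (2 * p + poly_x * q + poly_y * r + poly_z * s) A B"
    by (simp add: trace_basis_comb)
  then show ?thesis by blast
qed

section \<open>Small matrices with prescribed traces\<close>

text \<open>Take a root of \<open>l\<^sup>2 - x l + 1\<close>; the other root \<open>x - l\<close>
  is its inverse.\<close>

lemma ex_add_inverse_eq:
  obtains l :: complex where "l \<noteq> 0" "l + 1 / l = x"
proof -
  define l where "l = (x + csqrt (x\<^sup>2 - 4)) / 2"
  have eq: "l * (x - l) = 1"
    using power2_csqrt[of "x\<^sup>2 - 4"] by (simp add: l_def field_simps power2_eq_square)
  then have "l \<noteq> 0" by auto
  moreover from this eq have "x - l = 1 / l"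
    by (metis nonzero_mult_div_cancel_left)
  ultimately show thesis
    using that[of l] by (simp flip: \<open>x - l = 1 / l\<close>)
qed

text \<open>Replacing \<open>m\<close> by \<open>1 / m\<close> changes \<open>l m + 1 / (l m)\<close> into the other root of the polynomial
  \<open>z\<^sup>2 - x y z + x\<^sup>2 + y\<^sup>2 - 4\<close> in \<open>z\<close>, so one of the two choices is close to \<open>z\<close>.\<close>

lemma ex_eigenvalues:
  fixes x y z :: complex
  obtains l m where "l \<noteq> 0" "m \<noteq> 0" "l + 1 / l = x" "m + 1 / m = y"
    "(cmod (z - l * m - 1 / (l * m)))\<^sup>2 \<le> cmod (z\<^sup>2 - x * y * z + x\<^sup>2 + y\<^sup>2 - 4)"
proof -
  obtain l where l: "l \<noteq> 0" "l + 1 / l = x" by (rule ex_add_inverse_eq)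
  obtain m where m: "m \<noteq> 0" "m + 1 / m = y" by (rule ex_add_inverse_eq)
  define P where "P = z - l * m - 1 / (l * m)"
  define Q where "Q = z - l * (1 / m) - 1 / (l * (1 / m))"
  have "P * Q = z\<^sup>2 - x * y * z + x\<^sup>2 + y\<^sup>2 - 4"
    unfolding P_def Q_def l(2)[symmetric] m(2)[symmetric]
    using l(1) m(1) by (simp add: field_simps power2_eq_square)
  then have PQ: "cmod P * cmod Q = cmod (z\<^sup>2 - x * y * z + x\<^sup>2 + y\<^sup>2 - 4)"
    by (metis norm_mult)
  show thesis
  \<comment> \<open>The smaller of the two moduli has square at most the product.\<close>
  proof (cases "cmod P \<le> cmod Q")
    case True
    then have "(cmod P)\<^sup>2 \<le> cmod P * cmod Q"
      by (simp add: power2_eq_square mult_left_mono)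
    with that[of l m] l m PQ show thesis by (simp add: P_def)
  next
    case False
    then have "(cmod Q)\<^sup>2 \<le> cmod P * cmod Q"
      by (simp add: power2_eq_square mult_right_mono)
    with that[of l "1 / m"] l m PQ show thesis by (simp add: Q_def add.commute)
  qed
qed

section \<open>Squared Frobenius norms of words\<close>

definition frob2 :: "complex^2^2 \<Rightarrow> real" where
  "frob2 M = (cmod (M $ 1 $ 1))\<^sup>2 + (cmod (M $ 1 $ 2))\<^sup>2 + (cmod (M $ 2 $ 1))\<^sup>2 + (cmod (M $ 2 $ 2))\<^sup>2"

text \<open>Cauchy-Schwarz, from Lagrange's identity for the moduli.\<close>

lemma cmod_dot2_le:
  "(cmod (a * c + b * d))\<^sup>2 \<le> ((cmod a)\<^sup>2 + (cmod b)\<^sup>2) * ((cmod c)\<^sup>2 + (cmod d)\<^sup>2)"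
proof -
  have "(cmod (a * c + b * d))\<^sup>2 \<le> (cmod a * cmod c + cmod b * cmod d)\<^sup>2"
    using norm_triangle_ineq[of "a * c" "b * d"] by (intro power_mono) (auto simp: norm_mult)
  also have "\<dots> = ((cmod a)\<^sup>2 + (cmod b)\<^sup>2) * ((cmod c)\<^sup>2 + (cmod d)\<^sup>2) - (cmod a * cmod d - cmod b * cmod c)\<^sup>2"
    by (simp add: power2_eq_square algebra_simps)
  finally show ?thesis by (smt (verit) zero_le_power2)
qed

lemma frob2_mult_le: "frob2 (M ** N) \<le> frob2 M * frob2 N"
proof -
  let ?R = "\<lambda>i. (cmod (M $ i $ 1))\<^sup>2 + (cmod (M $ i $ 2))\<^sup>2"
  let ?C = "\<lambda>j. (cmod (N $ 1 $ j))\<^sup>2 + (cmod (N $ 2 $ j))\<^sup>2"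
  have "(cmod ((M ** N) $ i $ j))\<^sup>2 \<le> ?R i * ?C j" for i j
    using cmod_dot2_le[of "M $ i $ 1" "N $ 1 $ j" "M $ i $ 2" "N $ 2 $ j"]
    by (simp add: matrix_matrix_mult_def sum_2)
  then have "frob2 (M ** N) \<le> ?R 1 * ?C 1 + ?R 1 * ?C 2 + ?R 2 * ?C 1 + ?R 2 * ?C 2"
    unfolding frob2_def by (intro add_mono)
  also have "\<dots> = frob2 M * frob2 N"
    by (simp add: frob2_def algebra_simps)
  finally show ?thesis .
qed

lemma frob2_nonneg: "frob2 M \<ge> 0"
  by (simp add: frob2_def)

text \<open>The adjugate only permutes entries and changes signs, so inversion preserves
  \<open>frob2\<close>.\<close>

lemma frob2_letter_eval_le:
  assumes "A \<in> SL2" "B \<in> SL2" "frob2 A \<le> K" "frob2 B \<le> K"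
  shows "frob2 (letter_eval A B l) \<le> K"
  using assms
  by (auto simp: letter_eval_def Let_def matrix_inv_SL2 frob2_def add_ac split: gen.splits)

lemma frob2_word_eval_le:
  assumes "A \<in> SL2" "B \<in> SL2" "frob2 A \<le> K" "frob2 B \<le> K"
  shows "frob2 (word_eval A B w) \<le> 2 * K ^ length w"
proof (induction w)
  case Nil
  show ?case by (simp add: frob2_def mat_def)
next
  case (Cons l w)
  have "frob2 (word_eval A B (l # w)) \<le> frob2 (letter_eval A B l) * frob2 (word_eval A B w)"
    by (simp add: frob2_mult_le)
  moreover have "K \<ge> 0"
    using assms(3) frob2_nonneg[of A] by linarith
  then have "frob2 (letter_eval A B l) * frob2 (word_eval A B w) \<le> K * (2 * K ^ length w)"
    using mult_mono[OF frob2_letter_eval_le[OF assms, of l] Cons _ frob2_nonneg] by blast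
  ultimately show ?case by (simp add: mult_ac)
qed

lemma trace_frob2: "(cmod (trace M))\<^sup>2 \<le> 2 * frob2 M"
proof -
  have "(cmod (trace M))\<^sup>2 \<le> 2 * ((cmod (M $ 1 $ 1))\<^sup>2 + (cmod (M $ 2 $ 2))\<^sup>2)"
    using cmod_dot2_le[of 1 "M $ 1 $ 1" 1 "M $ 2 $ 2"] by (simp add: trace_def sum_2)
  then show ?thesis
    unfolding frob2_def by (smt (verit) zero_le_power2)
qed

text \<open>Square the reverse triangle inequality; since the moduli of \<open>l\<close> and
  \<open>1 / l\<close> have product 1, the cross term contributes the constant 2.\<close>

lemma eigenvalue_norm_le:
  assumes "l \<noteq> 0" "cmod (l + 1 / l) \<le> r"
  shows "(cmod l)\<^sup>2 + (cmod (1 / l))\<^sup>2 \<le> r\<^sup>2 + 2"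
proof -
  have "\<bar>cmod l - cmod (1 / l)\<bar> \<le> cmod (l + 1 / l)"
    using norm_triangle_ineq3[of l "- (1 / l)"] by simp
  then have "\<bar>cmod l - cmod (1 / l)\<bar>\<^sup>2 \<le> r\<^sup>2"
    using assms by (intro power_mono) auto
  moreover have "cmod l * cmod (1 / l) = 1"
    using assms by (simp add: norm_divide)
  ultimately show ?thesis by (simp add: power2_diff)
qed

text \<open>The diagonals carry the eigenvalues, and the product of the two off-diagonal entries
  supplies the defect \<open>t\<close> in the trace of \<open>A ** B\<close>. One pair serves every
  admissible \<open>r\<close>.\<close>

lemma ex_SL2_traces:
  fixes x y z :: complex
  obtains A B where "A \<in> SL2" "B \<in> SL2" "trace A = x" "trace B = y" "trace (A ** B) = z"
    "\<And>r. r \<ge> 1 \<Longrightarrow> cmod x \<le> r \<Longrightarrow> cmod y \<le> r \<Longrightarrow> cmod z \<le> r \<Longrightarrow>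
      frob2 A \<le> (3 + sqrt 8) * r\<^sup>2 \<and> frob2 B \<le> (3 + sqrt 8) * r\<^sup>2"
proof -
  obtain l m where lm: "l \<noteq> 0" "m \<noteq> 0" "l + 1 / l = x" "m + 1 / m = y"
    and close: "(cmod (z - l * m - 1 / (l * m)))\<^sup>2 \<le> cmod (z\<^sup>2 - x * y * z + x\<^sup>2 + y\<^sup>2 - 4)"
    by (rule ex_eigenvalues)
  define t where "t = z - l * m - 1 / (l * m)"
  \<comment> \<open>Splitting \<open>t\<close> into two factors of equal modulus shares its cost
    evenly between the two matrices.\<close>
  define s where "s = complex_of_real (sqrt (cmod t))"
  have s2: "(cmod s)\<^sup>2 = cmod t" by (simp add: s_def)
  \<comment> \<open>If \<open>t = 0\<close> then \<open>s = 0\<close>, and division by zero gives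
    \<open>t / s = 0\<close> as required.\<close>
  have st: "s * (t / s) = t" "(cmod (t / s))\<^sup>2 = cmod t"
    by (cases "t = 0"; simp add: s_def norm_divide power_divide; simp add: power2_eq_square)+
  define A :: "complex^2^2" where "A = vector [vector [l, s], vector [0, 1 / l]]"
  define B :: "complex^2^2" where "B = vector [vector [m, 0], vector [t / s, 1 / m]]"
  have A: "A $ 1 $ 1 = l" "A $ 1 $ 2 = s" "A $ 2 $ 1 = 0" "A $ 2 $ 2 = 1 / l"
    and B: "B $ 1 $ 1 = m" "B $ 1 $ 2 = 0" "B $ 2 $ 1 = t / s" "B $ 2 $ 2 = 1 / m"
    by (simp_all add: A_def B_def vector_2)
  show thesis
  proof (rule that[of A B])
    show "A \<in> SL2" "B \<in> SL2"
      using lm by (simp_all add: SL2_def det_2 A B)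
    show "trace A = x" "trace B = y"
      using lm by (simp_all add: trace_def sum_2 A B)
    have "trace (A ** B) = l * m + s * (t / s) + 1 / (l * m)"
      by (simp add: trace_def sum_2 matrix_matrix_mult_def A B del: times_divide_eq_right)
    then show "trace (A ** B) = z"
      unfolding st by (simp add: t_def)
    fix r :: real
    assume r: "r \<ge> 1" "cmod x \<le> r" "cmod y \<le> r" "cmod z \<le> r"
    have pow: "r ^ i \<le> r ^ 4" if "i \<le> 4" for i
      using r that by (intro power_increasing) auto
    have "cmod (z\<^sup>2 - x * y * z + x\<^sup>2 + y\<^sup>2 - 4) \<le> cmod z ^ 2 + cmod x * cmod y * cmod z + cmod x ^ 2 + cmod y ^ 2 + 4"
      using norm_triangle_ineq4[of "z\<^sup>2 - x * y * z + x\<^sup>2 + y\<^sup>2" 4]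
        norm_triangle_ineq[of "z\<^sup>2 - x * y * z + x\<^sup>2" "y\<^sup>2"]
        norm_triangle_ineq[of "z\<^sup>2 - x * y * z" "x\<^sup>2"] norm_triangle_ineq4[of "z\<^sup>2" "x * y * z"]
      unfolding norm_mult norm_power norm_numeral by linarith
    also have "\<dots> \<le> r ^ 2 + r * r * r + r ^ 2 + r ^ 2 + 4"
      using r by (intro add_mono mult_mono power_mono) auto
    \<comment> \<open>Here \<open>8 = 1 + 1 + 1 + 1 + 4\<close>, as each power of \<open>r\<close>
      is at most \<open>r ^ 4\<close>.\<close>
    also have "\<dots> \<le> 8 * r ^ 4"
      using pow[of 2] pow[of 3] pow[of 0] by (simp add: power3_eq_cube)
    also have "\<dots> = (sqrt 8 * r\<^sup>2)\<^sup>2"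
      by (simp add: power_mult_distrib)
    finally have "(cmod t)\<^sup>2 \<le> (sqrt 8 * r\<^sup>2)\<^sup>2"
      using close unfolding t_def by linarith
    then have t: "cmod t \<le> sqrt 8 * r\<^sup>2"
      by (rule power2_le_imp_le) simp
    \<comment> \<open>This absorbs the constant: \<open>r\<^sup>2 + 2\<close> is at most
      \<open>3 * r\<^sup>2\<close>.\<close>
    have "1 \<le> r\<^sup>2" using r by simp
    moreover have "(cmod l)\<^sup>2 + (cmod (1 / l))\<^sup>2 \<le> r\<^sup>2 + 2" "(cmod m)\<^sup>2 + (cmod (1 / m))\<^sup>2 \<le> r\<^sup>2 + 2"
      using lm r by (simp_all add: eigenvalue_norm_le)
    ultimately show "frob2 A \<le> (3 + sqrt 8) * r\<^sup>2 \<and> frob2 B \<le> (3 + sqrt 8) * r\<^sup>2"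
      using t s2 st(2) unfolding frob2_def A B by (simp add: algebra_simps)
  qed
qed

section \<open>Uniqueness and conjugation invariance of trace polynomials\<close>

lemma trace_poly_unique:
  assumes "\<And>A B. A \<in> SL2 \<Longrightarrow> B \<in> SL2 \<Longrightarrow> trace (word_eval A B w) = trace_eval f A B"
  shows "trace_poly w = f"
  unfolding trace_poly_def
proof (rule the_equality)
  show "\<forall>A\<in>SL2. \<forall>B\<in>SL2. trace (word_eval A B w) = eval3 f (trace A) (trace B) (trace (A ** B))"
    using assms by (simp add: trace_eval_def)
  fix g
  assume g: "\<forall>A\<in>SL2. \<forall>B\<in>SL2. trace (word_eval A B w) = eval3 g (trace A) (trace B) (trace (A ** B))"
  show "g = f"
  proof (rule eval3_inject)
    fix x y z
    \<comment> \<open>Every complex triple is a trace triple, so agreement on pairs in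
      \<open>SL2\<close> is agreement everywhere.\<close>
    obtain A B where "A \<in> SL2" "B \<in> SL2" "trace A = x" "trace B = y" "trace (A ** B) = z"
      by (rule ex_SL2_traces)
    then show "eval3 g x y z = eval3 f x y z"
      using assms g by (auto simp: trace_eval_def)
  qed
qed

lemma trace_word_eval:
  assumes "A \<in> SL2" "B \<in> SL2"
  shows "trace (word_eval A B w) = trace_eval (trace_poly w) A B"
proof -
  obtain f where f: "\<And>A B. A \<in> SL2 \<Longrightarrow> B \<in> SL2 \<Longrightarrow> trace (word_eval A B w) = trace_eval f A B"
    using ex_trace_poly by blast
  then have "trace_poly w = f" by (rule trace_poly_unique)
  with f assms show ?thesis by simp
qed

lemma trace_poly_conjugate:
  assumes "conjugate_F2 u w" "w \<in> carrier F2"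
  shows "trace_poly u = trace_poly w"
proof (rule trace_poly_unique)
  fix A B assume AB: "A \<in> SL2" "B \<in> SL2"
  interpret group F2 by (rule group_F2)
  obtain g where g: "g \<in> carrier F2" "u = g \<otimes>\<^bsub>F2\<^esub> w \<otimes>\<^bsub>F2\<^esub> inv\<^bsub>F2\<^esub> g"
    using assms by (auto simp: conjugate_F2_def)
  have "word_eval A B (inv\<^bsub>F2\<^esub> g) ** word_eval A B g = mat 1"
    using g by (simp add: word_eval_mult[OF AB, symmetric] one_F2)
  then have "trace (word_eval A B u) = trace (word_eval A B w)"
    unfolding g(2) word_eval_mult[OF AB] trace_mul_sym[of "_ ** _" "word_eval A B (inv\<^bsub>F2\<^esub> g)"]
    by (simp add: matrix_mul_assoc)
  then show "trace (word_eval A B u) = trace_eval (trace_poly w) A B"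
    by (simp add: trace_word_eval[OF AB])
qed

section \<open>Upper bounds\<close>

text \<open>The constant \<open>q\<close> is kept abstract: the norm bounds use
  \<open>\<phi>\<^sub>0\<close>, the degree bound uses 3.\<close>

lemma trace_poly_eval_bound:
  assumes q: "q \<ge> 0" "3 + sqrt 8 \<le> q\<^sup>2"
    and r: "r \<ge> 1" "cmod x \<le> r" "cmod y \<le> r" "cmod z \<le> r"
  shows "cmod (eval3 (trace_poly w) x y z) \<le> 2 * (q * r) ^ length w"
proof -
  obtain A B where AB: "A \<in> SL2" "B \<in> SL2" "trace A = x" "trace B = y" "trace (A ** B) = z"
    and "frob2 A \<le> (3 + sqrt 8) * r\<^sup>2 \<and> frob2 B \<le> (3 + sqrt 8) * r\<^sup>2"
    by (rule ex_SL2_traces[of x y z]) (use r in blast)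
  moreover have "(3 + sqrt 8) * r\<^sup>2 \<le> (q * r)\<^sup>2"
    using q by (simp add: power_mult_distrib mult_right_mono)
  ultimately have "frob2 A \<le> (q * r)\<^sup>2" "frob2 B \<le> (q * r)\<^sup>2"
    by linarith+
  then have "frob2 (word_eval A B w) \<le> 2 * ((q * r)\<^sup>2) ^ length w"
    using AB by (intro frob2_word_eval_le)
  then have "(cmod (trace (word_eval A B w)))\<^sup>2 \<le> 4 * ((q * r)\<^sup>2) ^ length w"
    using trace_frob2[of "word_eval A B w"] by linarith
  also have "\<dots> = (2 * (q * r) ^ length w)\<^sup>2"
    unfolding power_mult[symmetric] by (simp add: power_mult_distrib mult.commute flip: power_mult)
  finally have "cmod (trace (word_eval A B w)) \<le> 2 * (q * r) ^ length w"
    by (rule power2_le_imp_le) (use q r in auto)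
  then show ?thesis
    using AB by (simp add: trace_word_eval trace_eval_def)
qed

lemma trace_poly_coeff_bound:
  assumes "q \<ge> 0" "3 + sqrt 8 \<le> q\<^sup>2" "r \<ge> 1"
  shows "\<bar>real_of_int (Poly_Mapping.lookup (trace_poly w) m)\<bar> * r ^ deg3 m \<le> 2 * (q * r) ^ length w"
  using assms by (intro coeff_bound_torus trace_poly_eval_bound) auto

text \<open>Compare the growth of both sides of the coefficient bound as the radius tends to infinity.\<close>

lemma deg3_trace_poly_le:
  assumes "Poly_Mapping.lookup (trace_poly w) m \<noteq> 0"
  shows "deg3 m \<le> length w"
proof (rule ccontr)
  let ?n = "length w"
  assume "\<not> deg3 m \<le> ?n"
  then have deg: "Suc ?n \<le> deg3 m" by simp
  have "sqrt 8 \<le> sqrt (3\<^sup>2)"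
    by (intro real_sqrt_le_mono) simp
  then have q: "3 + sqrt 8 \<le> 3\<^sup>2" by simp
  \<comment> \<open>A nonzero integer coefficient in degree above the length would force
    \<open>r \<le> 2 * 3 ^ ?n\<close>, which this radius just violates.\<close>
  define r :: real where "r = 2 * 3 ^ ?n + 1"
  have r: "r \<ge> 1" by (simp add: r_def)
  have "r * r ^ ?n \<le> 1 * r ^ deg3 m"
    using power_increasing[OF deg r] by simp
  also have "\<dots> \<le> \<bar>real_of_int (Poly_Mapping.lookup (trace_poly w) m)\<bar> * r ^ deg3 m"
    using assms r by (intro mult_right_mono) auto
  also have "\<dots> \<le> 2 * (3 * r) ^ ?n"
    using q r by (intro trace_poly_coeff_bound) auto
  also have "\<dots> = (2 * 3 ^ ?n) * r ^ ?n"
    by (simp add: power_mult_distrib)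
  finally have "r \<le> 2 * 3 ^ ?n"
    using r by simp
  then show False by (simp add: r_def)
qed

lemma trace_poly_norm_bounds:
  assumes "q \<ge> 0" "3 + sqrt 8 \<le> q\<^sup>2"
  shows "real_of_int (norm_inf (trace_poly w)) \<le> 2 * q ^ length w"
    and "real_of_int (norm_one (trace_poly w)) \<le> 2 * real ((length w + 3) choose 3) * q ^ length w"
proof -
  obtain m where "norm_inf (trace_poly w) = \<bar>Poly_Mapping.lookup (trace_poly w) m\<bar>"
    using norm_inf_attained by blast
  then show inf: "real_of_int (norm_inf (trace_poly w)) \<le> 2 * q ^ length w"
    using trace_poly_coeff_bound[OF assms, of 1 w m] by simp
  have "norm_one (trace_poly w) \<le> int ((length w + 3) choose 3) * norm_inf (trace_poly w)"
    by (rule norm_one_le_deg) (rule deg3_trace_poly_le)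
  then have "real_of_int (norm_one (trace_poly w)) \<le>
      real ((length w + 3) choose 3) * real_of_int (norm_inf (trace_poly w))"
    by (metis of_int_le_iff of_int_mult of_int_of_nat_eq)
  also have "\<dots> \<le> real ((length w + 3) choose 3) * (2 * q ^ length w)"
    using inf by (intro mult_left_mono) auto
  finally show "real_of_int (norm_one (trace_poly w)) \<le> 2 * real ((length w + 3) choose 3) * q ^ length w"
    by (simp add: mult_ac)
qed

section \<open>Lower bounds for powers of a generator\<close>

text \<open>In Chebyshev's notation this is \<open>2 T_n(x / 2)\<close>.\<close>

definition power_trace_poly :: "nat \<Rightarrow> poly3" where
  "power_trace_poly n = trace_poly (gen_a [^]\<^bsub>F2\<^esub> n)"

lemma gen_a_carrier: "gen_a \<in> carrier F2"
  by (simp add: gen_a_def carrier_F2)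

lemma word_eval_gen_a_pow_Suc:
  assumes "A \<in> SL2" "B \<in> SL2"
  shows "word_eval A B (gen_a [^]\<^bsub>F2\<^esub> Suc n) = A ** word_eval A B (gen_a [^]\<^bsub>F2\<^esub> n)"
proof -
  interpret group F2 by (rule group_F2)
  have "gen_a [^]\<^bsub>F2\<^esub> Suc n = gen_a \<otimes>\<^bsub>F2\<^esub> gen_a [^]\<^bsub>F2\<^esub> n"
    by (rule nat_pow_Suc2[OF gen_a_carrier])
  then show ?thesis
    using assms by (simp add: word_eval_mult) (simp add: gen_a_def letter_eval_def)
qed

lemma word_eval_gen_a_pow_0: "word_eval A B (gen_a [^]\<^bsub>F2\<^esub> (0::nat)) = mat 1"
  by (simp add: nat_pow_def one_F2)

lemma power_trace_poly_0: "power_trace_poly 0 = 2"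
  unfolding power_trace_poly_def
  by (rule trace_poly_unique, simp only: word_eval_gen_a_pow_0) (simp add: trace_def mat_def sum_2)

lemma power_trace_poly_1: "power_trace_poly (Suc 0) = poly_x"
  unfolding power_trace_poly_def
  by (rule trace_poly_unique, simp only: word_eval_gen_a_pow_0 word_eval_gen_a_pow_Suc) simp

lemma power_trace_poly_rec:
  "power_trace_poly (Suc (Suc n)) = poly_x * power_trace_poly (Suc n) - power_trace_poly n"
  unfolding power_trace_poly_def
proof (rule trace_poly_unique)
  fix A B assume AB: "A \<in> SL2" "B \<in> SL2"
  let ?W = "\<lambda>n. word_eval A B (gen_a [^]\<^bsub>F2\<^esub> n)"
  have "trace (?W (Suc (Suc n))) = trace A * trace (?W (Suc n)) - trace (?W n)"
    unfolding word_eval_gen_a_pow_Suc[OF AB]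
    by (simp add: trace_def sum_2 SL2_square_mult[OF AB(1)]) (simp add: trace_def sum_2 algebra_simps)
  then show "trace (?W (Suc (Suc n))) =
      trace_eval (poly_x * trace_poly (gen_a [^]\<^bsub>F2\<^esub> Suc n) - trace_poly (gen_a [^]\<^bsub>F2\<^esub> n)) A B"
    by (simp add: trace_word_eval[OF AB] del: nat_pow_Suc)
qed

lemma eval3_power_trace_poly:
  assumes "l \<noteq> 0"
  shows "eval3 (power_trace_poly n) (l + 1 / l) y z = l ^ n + (1 / l) ^ n"
proof (induction n rule: induct_nat_012)
  case 0
  show ?case by (simp add: power_trace_poly_0 eval3_numeral)
next
  case 1
  show ?case by (simp add: power_trace_poly_1 poly_x_def eval3_single)
next
  case (ge2 n)
  then show ?case
    using assms
    by (simp add: power_trace_poly_rec eval3_diff eval3_mult)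
      (simp add: poly_x_def eval3_single field_simps)
qed

text \<open>Multiplication by \<open>poly_x\<close> does not increase the norm, so the recursion
  gives a Fibonacci-type inequality, solved by \<phi>.\<close>

lemma norm_one_power_trace_poly_le:
  assumes "\<phi> \<ge> 1" "\<phi>\<^sup>2 = \<phi> + 1"
  shows "real_of_int (norm_one (power_trace_poly n)) \<le> 2 * \<phi> ^ n"
proof (induction n rule: induct_nat_012)
  case 0
  have "norm_one 2 = 2"
    using norm_one_single[of 0 2] by simp
  then show ?case by (simp add: power_trace_poly_0)
next
  case 1
  then show ?case using assms by (simp add: power_trace_poly_1 poly_x_def norm_one_single)
next
  case (ge2 n)
  have "norm_one (power_trace_poly (Suc (Suc n))) \<le>
      norm_one (poly_x * power_trace_poly (Suc n)) + norm_one (power_trace_poly n)"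
    unfolding power_trace_poly_rec by (rule norm_one_diff_le)
  also have "norm_one (poly_x * power_trace_poly (Suc n)) \<le> norm_one (power_trace_poly (Suc n))"
    using norm_one_monomial_mult_le[of _ 1] by (simp add: poly_x_def)
  finally have "real_of_int (norm_one (power_trace_poly (Suc (Suc n)))) \<le> 2 * \<phi> ^ Suc n + 2 * \<phi> ^ n"
    using ge2 by linarith
  also have "\<dots> = 2 * (\<phi> ^ n * (\<phi> + 1))"
    by (simp add: algebra_simps)
  also have "\<dots> = 2 * \<phi> ^ Suc (Suc n)"
    unfolding assms(2)[symmetric] by (simp add: power2_eq_square)
  finally show ?case .
qed

text \<open>Write \<open>x = l + 1 / l\<close> with \<open>l\<close> outside the open unit disc and
  modulus \<open>\<rho>\<close>. Then the imaginary part of \<open>x\<close> is at most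
  \<open>\<rho> - 1 / \<rho>\<close> in modulus, which forces \<open>\<rho>\<close> close to \<phi>
  or larger, and \<open>l ^ n\<close> dominates its inverse.\<close>

lemma power_trace_poly_eval_ge:
  assumes phi: "\<phi> \<ge> 8 / 5" "\<phi>\<^sup>2 = \<phi> + 1"
    and n: "n \<ge> 1" and eps: "0 \<le> \<epsilon>" "\<epsilon> \<le> 1 / (4 * real n)" and x: "\<bar>Im x\<bar> \<ge> 1 - \<epsilon>"
  shows "cmod (eval3 (power_trace_poly n) x y z) \<ge> \<phi> ^ n / 5"
proof -
  have "\<exists>l. l \<noteq> 0 \<and> l + 1 / l = x \<and> cmod l \<ge> 1"
  proof -
    obtain l where l: "l \<noteq> 0" "l + 1 / l = x" by (rule ex_add_inverse_eq)
    show ?thesis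
    proof (cases "cmod l \<ge> 1")
      case False
      then have "cmod (1 / l) \<ge> 1" using l by (simp add: norm_divide)
      with l show ?thesis by (intro exI[of _ "1 / l"]) (simp add: add.commute)
    qed (use l in blast)
  qed
  then obtain l where l: "l \<noteq> 0" "l + 1 / l = x" "cmod l \<ge> 1" by blast
  define \<rho> where "\<rho> = cmod l"
  have \<rho>: "\<rho> \<ge> 1" using l by (simp add: \<rho>_def)
  have "Im x = Im l * (1 - 1 / \<rho>\<^sup>2)"
    unfolding l(2)[symmetric] \<rho>_def cmod_power2 by (simp add: Im_divide algebra_simps)
  moreover have inv2: "1 / \<rho>\<^sup>2 \<le> 1"
    using \<rho> by simp
  ultimately have "\<bar>Im x\<bar> = \<bar>Im l\<bar> * (1 - 1 / \<rho>\<^sup>2)"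
    by (simp add: abs_mult)
  also have "\<dots> \<le> \<rho> * (1 - 1 / \<rho>\<^sup>2)"
    using inv2 abs_Im_le_cmod[of l] by (intro mult_right_mono) (simp_all add: \<rho>_def)
  also have "\<dots> = \<rho> - 1 / \<rho>"
    using \<rho> by (simp add: field_simps power2_eq_square)
  finally have Im_le: "1 - \<epsilon> \<le> \<rho> - 1 / \<rho>" using x by simp
  have "real n \<ge> 1" using n by simp
  then have "1 / (4 * real n) \<le> 1 / 4"
    by (simp add: field_simps)
  then have eps4: "\<epsilon> \<le> 1 / 4" using eps by linarith
  have inv_phi: "1 / \<phi> = \<phi> - 1"
    using phi by (simp add: field_simps power2_eq_square)
  have \<rho>_ge: "\<rho> \<ge> \<phi> * (1 - \<epsilon>)"
  \<comment> \<open>Otherwise \<open>\<rho> \<le> \<phi>\<close>, so \<open>1 / \<rho>\<close> is at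
    least \<open>1 / \<phi> = \<phi> - 1\<close> and \<open>\<rho> - 1 / \<rho>\<close> falls below
    \<open>1 - \<epsilon>\<close>.\<close>
  proof (rule ccontr)
    assume "\<not> ?thesis"
    then have less: "\<rho> < \<phi> * (1 - \<epsilon>)" by simp
    have "\<phi> * (1 - \<epsilon>) \<le> \<phi> * 1" using phi eps by (intro mult_left_mono) auto
    with less have "\<rho> \<le> \<phi>" by simp
    then have "1 / \<phi> \<le> 1 / \<rho>" using \<rho> by (simp add: frac_le)
    then have "\<rho> - 1 / \<rho> < \<phi> * (1 - \<epsilon>) - (\<phi> - 1)" using less inv_phi by linarith
    also have "\<dots> = 1 - \<phi> * \<epsilon>" by (simp add: algebra_simps)
    also have "\<dots> \<le> 1 - 1 * \<epsilon>"
      using phi eps by (intro diff_left_mono mult_right_mono) auto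
    finally show False using Im_le by simp
  qed
  \<comment> \<open>The tolerance of order \<open>1 / n\<close> costs only a constant factor, by
    Bernoulli's inequality.\<close>
  have "(1 - \<epsilon>) ^ n \<ge> 1 - real n * \<epsilon>"
    using Bernoulli_inequality[of "- \<epsilon>" n] eps4 by simp
  moreover have "real n * \<epsilon> \<le> 1 / 4"
    using eps n by (simp add: field_simps)
  ultimately have "3 / 4 * \<phi> ^ n \<le> (1 - \<epsilon>) ^ n * \<phi> ^ n"
    using phi by (intro mult_right_mono) auto
  also have "\<dots> = (\<phi> * (1 - \<epsilon>)) ^ n"
    by (simp add: power_mult_distrib)
  also have "\<dots> \<le> \<rho> ^ n"
    using \<rho>_ge phi eps4 by (intro power_mono) auto
  finally have pow: "3 / 4 * \<phi> ^ n \<le> \<rho> ^ n" .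
  have "8 / 5 * (3 / 4) \<le> \<phi> * (1 - \<epsilon>)"
    using phi eps4 by (intro mult_mono) auto
  then have \<rho>65: "6 / 5 \<le> \<rho>" using \<rho>_ge by simp
  have "6 / 5 \<le> \<rho> ^ n"
    using \<rho>65 n self_le_power[of \<rho> n] by simp
  then have "6 / 5 * (6 / 5) \<le> \<rho> ^ n * \<rho> ^ n"
    by (intro mult_mono) auto
  then have inv: "1 / \<rho> ^ n \<le> 25 / 36 * \<rho> ^ n"
    using \<rho> by (simp add: field_simps)
  \<comment> \<open>Here \<open>11 / 36 = 1 - 25 / 36\<close>, and
    \<open>11 / 36 * (3 / 4) = 11 / 48\<close> exceeds \<open>1 / 5\<close>.\<close>
  have "\<phi> ^ n / 5 \<le> 11 / 36 * \<rho> ^ n"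
    using pow phi zero_le_power[of \<phi> n] by linarith
  also have "\<dots> \<le> \<rho> ^ n - 1 / \<rho> ^ n"
    using inv by linarith
  also have "\<dots> = cmod (l ^ n) - cmod (- ((1 / l) ^ n))"
    by (simp add: \<rho>_def norm_power norm_divide power_one_over)
  also have "\<dots> \<le> cmod (l ^ n - - ((1 / l) ^ n))"
    by (rule norm_triangle_ineq2)
  also have "\<dots> = cmod (eval3 (power_trace_poly n) x y z)"
    using eval3_power_trace_poly[OF l(1), of n y z] l by simp
  finally show ?thesis .
qed

lemma cos_ge_one_minus_half_square: "1 - \<delta>\<^sup>2 / 2 \<le> cos (\<delta>::real)"
proof -
  have "(sin (\<delta> / 2))\<^sup>2 \<le> (\<delta> / 2)\<^sup>2"
    using abs_sin_x_le_abs_x[of "\<delta> / 2"] abs_le_square_iff by blast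
  then show ?thesis
    using cos_double_sin[of "\<delta> / 2"] by (simp add: power_divide)
qed

lemma norm_one_power_trace_poly_ge:
  assumes phi: "\<phi> \<ge> 8 / 5" "\<phi>\<^sup>2 = \<phi> + 1" and n: "n \<ge> 1"
  shows "real_of_int (norm_one (power_trace_poly n)) \<ge> \<phi> ^ n / 5"
proof -
  have "\<phi> ^ n / 5 \<le> cmod (eval3 (power_trace_poly n) \<i> 0 0)"
    using n by (intro power_trace_poly_eval_ge[OF phi, where \<epsilon> = 0]) auto
  also have "\<dots> \<le> real_of_int (norm_one (power_trace_poly n))"
    by (intro norm_eval3_le_norm_one) auto
  finally show ?thesis .
qed

lemma norm_inf_power_trace_poly_ge:
  assumes phi: "\<phi> \<ge> 8 / 5" "\<phi>\<^sup>2 = \<phi> + 1" and n: "n \<ge> 1"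
  shows "real_of_int (norm_inf (power_trace_poly n)) \<ge> \<phi> ^ n / (800 * sqrt (real n))"
proof -
  define f where "f = power_trace_poly n"
  define S where "S = (\<Sum>m\<in>Poly_Mapping.keys f. (real_of_int (Poly_Mapping.lookup f m))\<^sup>2)"
  obtain M where M: "M > 0" "\<And>N. N \<ge> M \<Longrightarrow> Poly_Mapping.keys f \<subseteq> box3 N"
    using ex_box3 by blast
  \<comment> \<open>A multiple of four puts \<i> itself on the grid, at index
    \<open>M\<close>.\<close>
  define N where "N = 4 * M"
  have N: "N > 0" "Poly_Mapping.keys f \<subseteq> box3 N"
    using M by (auto simp: N_def)
  have sqrt_n: "sqrt (real n) \<ge> 1" using n by simp
  define J where "J = nat \<lfloor>real N / (16 * sqrt (real n))\<rfloor>"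
  have J_le: "real J \<le> real N / (16 * sqrt (real n))"
    unfolding J_def using sqrt_n by (intro of_nat_floor) auto
  \<comment> \<open>The arc has \<open>J + 1\<close> points including \<i>, so rounding down in
    \<open>J\<close> loses nothing.\<close>
  have J_ge: "real N / (16 * sqrt (real n)) \<le> real (J + 1)"
    unfolding J_def using sqrt_n by linarith
  have "real N / (16 * sqrt (real n)) \<le> real N / 16"
    using sqrt_n by (intro divide_left_mono) auto
  with J_le have "real J \<le> real N / 16" by linarith
  then have JN: "M + J < N" using M by (simp add: N_def)
  have large: "(\<phi> ^ n / 5)\<^sup>2 \<le> (cmod (eval3 f (of_real 1 * root_unity N a) y z))\<^sup>2"
    if a: "a \<in> {M..M + J}" for a y z
  proof (rule power_mono)
    define \<delta> where "\<delta> = 2 * pi * real (a - M) / real N"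
    have "2 * pi * real a / real N = pi / 2 + \<delta>"
      using a M(1) by (simp add: \<delta>_def N_def of_nat_diff field_simps)
    then have Im: "Im (root_unity N a) = cos \<delta>"
      by (simp add: root_unity_def sin_add)
    have "real (a - M) \<le> real J" using a by auto
    then have "real (a - M) / real N \<le> 1 / (16 * sqrt (real n))"
      using J_le N(1) by (simp add: field_simps)
    \<comment> \<open>With \<open>pi < 4\<close>, the 16 in \<open>J\<close> makes
      \<open>\<delta>\<close> at most \<open>1 / (2 * sqrt n)\<close>, hence a tolerance
      \<open>\<delta>\<^sup>2 / 2\<close> within \<open>1 / (4 n)\<close>.\<close>
    then have "2 * pi * (real (a - M) / real N) \<le> 2 * 4 * (1 / (16 * sqrt (real n)))"
      using pi_less_4 by (intro mult_mono) auto
    then have "\<delta> \<le> 1 / (2 * sqrt (real n))"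
      by (simp add: \<delta>_def)
    then have "\<delta>\<^sup>2 \<le> (1 / (2 * sqrt (real n)))\<^sup>2"
      by (intro power_mono) (auto simp: \<delta>_def)
    also have "\<dots> = (1 / 4) * (1 / real n)"
      by (simp add: power_divide power_mult_distrib)
    also have "\<dots> \<le> (1 / 2) * (1 / real n)"
      by (intro mult_right_mono) auto
    finally have "\<delta>\<^sup>2 / 2 \<le> 1 / (4 * real n)" by simp
    moreover have "\<bar>Im (root_unity N a)\<bar> \<ge> 1 - \<delta>\<^sup>2 / 2"
      using cos_ge_one_minus_half_square[of \<delta>] Im by simp
    ultimately show "\<phi> ^ n / 5 \<le> cmod (eval3 f (of_real 1 * root_unity N a) y z)"
      unfolding f_def using n by (intro power_trace_poly_eval_ge[OF phi, where \<epsilon> = "\<delta>\<^sup>2 / 2"]) auto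
    show "0 \<le> \<phi> ^ n / 5" using phi by simp
  qed
  \<comment> \<open>The 400 is 16 from the arc length times 25 from the squared lower bound.\<close>
  have "real N ^ 3 * (\<phi> ^ n * (\<phi> ^ n / (400 * sqrt (real n)))) =
      real N / (16 * sqrt (real n)) * (real N * real N) * (\<phi> ^ n / 5)\<^sup>2"
    using sqrt_n by (simp add: power3_eq_cube power2_eq_square)
  also have "\<dots> \<le> real (J + 1) * (real N * real N) * (\<phi> ^ n / 5)\<^sup>2"
    using J_ge by (intro mult_right_mono) auto
  also have "\<dots> = (\<Sum>p\<in>{M..M + J} \<times> {..<N} \<times> {..<N}. (\<phi> ^ n / 5)\<^sup>2)"
    by (simp add: card_cartesian_product algebra_simps)
  also have "\<dots> \<le> (\<Sum>(a, b, c)\<in>{M..M + J} \<times> {..<N} \<times> {..<N}. (cmod (eval3 f (of_real 1 * root_unity N a)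
      (of_real 1 * root_unity N b) (of_real 1 * root_unity N c)))\<^sup>2)"
    using large by (intro sum_mono) auto
  \<comment> \<open>By \<open>JN\<close> the arc does not leave the grid; the other grid points
    contribute nonnegative terms.\<close>
  also have "\<dots> \<le> (\<Sum>(a, b, c)\<in>box3 N. (cmod (eval3 f (of_real 1 * root_unity N a)
      (of_real 1 * root_unity N b) (of_real 1 * root_unity N c)))\<^sup>2)"
    using JN by (intro sum_mono2) (auto simp: box3_def)
  also have "\<dots> = real N ^ 3 * S"
    unfolding parseval3[OF N(2)] by (simp add: S_def)
  finally have "\<phi> ^ n * (\<phi> ^ n / (400 * sqrt (real n))) \<le> S"
    by (rule mult_left_le_imp_le) (use N(1) in simp)
  also have "S \<le> (\<Sum>m\<in>Poly_Mapping.keys f. real_of_int (norm_inf f) * real_of_int \<bar>Poly_Mapping.lookup f m\<bar>)"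
    unfolding S_def
  proof (intro sum_mono)
    fix m
    have "real_of_int \<bar>Poly_Mapping.lookup f m\<bar> \<le> real_of_int (norm_inf f)"
      using lookup_le_norm_inf by (simp only: of_int_le_iff)
    then have "real_of_int \<bar>Poly_Mapping.lookup f m\<bar> * real_of_int \<bar>Poly_Mapping.lookup f m\<bar> \<le>
        real_of_int (norm_inf f) * real_of_int \<bar>Poly_Mapping.lookup f m\<bar>"
      by (intro mult_right_mono) auto
    then show "(real_of_int (Poly_Mapping.lookup f m))\<^sup>2 \<le>
        real_of_int (norm_inf f) * real_of_int \<bar>Poly_Mapping.lookup f m\<bar>"
      by (simp add: power2_eq_square)
  qed
  also have "\<dots> = real_of_int (norm_inf f) * real_of_int (norm_one f)"
    by (simp add: norm_one_def sum_distrib_left)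
  also have "\<dots> \<le> real_of_int (norm_inf f) * (2 * \<phi> ^ n)"
    using norm_one_power_trace_poly_le[OF _ phi(2), of n] phi(1) lookup_le_norm_inf[of f 0]
    by (intro mult_left_mono) (auto simp: f_def)
  finally have "\<phi> ^ n * (\<phi> ^ n / (400 * sqrt (real n))) \<le> \<phi> ^ n * (2 * real_of_int (norm_inf f))"
    by (simp add: mult_ac)
  then have "\<phi> ^ n / (400 * sqrt (real n)) \<le> 2 * real_of_int (norm_inf f)"
    by (rule mult_left_le_imp_le) (use phi(1) in simp)
  then show ?thesis by (simp add: f_def)
qed

theorem theorem1p5:
  fixes \<phi> \<phi>\<^sub>0 :: real
  assumes "\<phi> = (1 + sqrt 5) / 2" and "\<phi>\<^sub>0 = sqrt (2 * \<phi>\<^sup>2 + 1)"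
  shows
    "(\<forall>w\<in>carrier F2. \<forall>n::nat. w \<noteq> \<one>\<^bsub>F2\<^esub> \<and> n = cyclically_reduced_length w \<longrightarrow>
        real_of_int (norm_inf (trace_poly w)) \<le> 2 * \<phi>\<^sub>0 ^ n \<and>
        real_of_int (norm_one (trace_poly w)) \<le> 2 * real ((n + 3) choose 3) * \<phi>\<^sub>0 ^ n)
     \<and>
     (\<exists>c::real. c > 0 \<and> (\<forall>n::nat. n \<ge> 1 \<longrightarrow>
        real_of_int (norm_one (trace_poly (gen_a [^]\<^bsub>F2\<^esub> n))) \<ge> c * \<phi> ^ n \<and>
        real_of_int (norm_inf (trace_poly (gen_a [^]\<^bsub>F2\<^esub> n))) \<ge> c * \<phi> ^ n / sqrt (real n)))"
proof (intro conjI)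
  have "sqrt ((11 / 5)\<^sup>2) \<le> sqrt 5"
    by (intro real_sqrt_le_mono) (simp add: power2_eq_square)
  then have sqrt5: "11 / 5 \<le> sqrt 5" by simp
  have phi: "\<phi> \<ge> 8 / 5" "\<phi>\<^sup>2 = \<phi> + 1"
    using sqrt5 by (simp_all add: assms(1) power2_eq_square field_simps)
  have "sqrt 8 \<le> sqrt (3\<^sup>2)"
    by (intro real_sqrt_le_mono) simp
  \<comment> \<open>Since \<open>\<phi> \<ge> 8 / 5\<close>, this value exceeds 6, whereas
    \<open>3 + sqrt 8\<close> is at most 6.\<close>
  moreover have "\<phi>\<^sub>0\<^sup>2 = 2 * \<phi> + 3"
    using phi by (simp add: assms(2))
  ultimately have phi0: "\<phi>\<^sub>0 \<ge> 0" "3 + sqrt 8 \<le> \<phi>\<^sub>0\<^sup>2"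
    using phi by (auto simp: assms(2))
  show "\<forall>w\<in>carrier F2. \<forall>n::nat. w \<noteq> \<one>\<^bsub>F2\<^esub> \<and> n = cyclically_reduced_length w \<longrightarrow>
        real_of_int (norm_inf (trace_poly w)) \<le> 2 * \<phi>\<^sub>0 ^ n \<and>
        real_of_int (norm_one (trace_poly w)) \<le> 2 * real ((n + 3) choose 3) * \<phi>\<^sub>0 ^ n"
  proof (intro ballI allI impI)
    fix w and n :: nat
    assume w: "w \<in> carrier F2" and "w \<noteq> \<one>\<^bsub>F2\<^esub> \<and> n = cyclically_reduced_length w"
    \<comment> \<open>The bounds in terms of word length are applied to a shortest representative of
      the conjugacy class, which has the same trace polynomial.\<close>
    then obtain u where u: "conjugate_F2 u w" "length u = n"
      using cyclically_reduced_length by metis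
    then show "real_of_int (norm_inf (trace_poly w)) \<le> 2 * \<phi>\<^sub>0 ^ n \<and>
        real_of_int (norm_one (trace_poly w)) \<le> 2 * real ((n + 3) choose 3) * \<phi>\<^sub>0 ^ n"
      using trace_poly_norm_bounds[OF phi0, of u] trace_poly_conjugate[OF u(1) w] by simp
  qed
  show "\<exists>c::real. c > 0 \<and> (\<forall>n::nat. n \<ge> 1 \<longrightarrow>
        real_of_int (norm_one (trace_poly (gen_a [^]\<^bsub>F2\<^esub> n))) \<ge> c * \<phi> ^ n \<and>
        real_of_int (norm_inf (trace_poly (gen_a [^]\<^bsub>F2\<^esub> n))) \<ge> c * \<phi> ^ n / sqrt (real n))"
  proof (intro exI[of _ "1 / 800"] conjI allI impI)
    fix n :: nat assume n: "n \<ge> 1"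
    have "\<phi> ^ n \<ge> 0" using phi by simp
    then show "1 / 800 * \<phi> ^ n \<le> real_of_int (norm_one (trace_poly (gen_a [^]\<^bsub>F2\<^esub> n)))"
      using norm_one_power_trace_poly_ge[OF phi n] by (simp add: power_trace_poly_def)
    show "1 / 800 * \<phi> ^ n / sqrt (real n) \<le> real_of_int (norm_inf (trace_poly (gen_a [^]\<^bsub>F2\<^esub> n)))"
      using norm_inf_power_trace_poly_ge[OF phi n] by (simp add: power_trace_poly_def)
  qed simp
qed

end
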